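(* There exists a finite dimensional algebra $B$ over an algebraically closed field $k$ and an indecomposable wild element $\theta\in K_0(\operatorname{proj}B)$ such that $\operatorname{cone}(\operatorname{ind}\theta)\subsetneq\operatorname{cone}(\operatorname{ind}\mathbb{N}\theta)$. In particular $\theta$ violates the ray condition: $\ell\theta$ is not indecomposable for some $\ell\ge1$.
   Context: For a finite dimensional $k$-algebra $B$, $K_0(\operatorname{proj}B)$ has basis the classes of indecomposable projectives. For $\theta$ write $\theta=[P_0]-[P_1]$ with no common nonzero summands, $\operatorname{Hom}(\theta)=\operatorname{Hom}_B(P_1,P_0)$, $P_f$ the 2-term complex $(P_1\xrightarrow{f}P_0)$ in $\mathsf{K}^b(\operatorname{proj}B)$; "general" = in a nonempty Zariski open dense subset. $\theta$ is indecomposable if $P_f$ is indecomposable for general $f$; wild if $\min_{f,g\in\operatorname{Hom}(\theta)}\dim_k\operatorname{Hom}_{\mathsf{K}^b}(P_f,P_g[1])\ne0$. A canonical decomposition $\theta=\theta_1\oplus\cdots\oplus\theta_m$ has $\theta=\sum\theta_i$, each $\theta_i$ indecomposable, and for general $f\in\operatorname{Hom}(\theta)$, $P_f\cong\bigoplus P_{f_i}$ with $f_i\in\operatorname{Hom}(\theta_i)$; it is unique up to order; $\operatorname{ind}\theta=\{\theta_1,\dots,\theta_m\}$, $\operatorname{ind}\mathbb{N}\theta=\bigcup_{\ell\ge1}\operatorname{ind}\ell\theta$, $\operatorname{cone}X=\sum_{x\in X}\mathbb{R}_{\ge0}x$. *)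

theory Defs
  imports "HOL-Computational_Algebra.Polynomial" "HOL-Library.Function_Algebras"
begin

text \<open>Every finite dimensional k-algebra is isomorphic (via its regular representation)
to a subalgebra of the N x N matrices over k.  We represent an N x N matrix as a function
nat => nat => k that vanishes outside {..<N} x {..<N}.\<close>

type_synonym 'k sq = "nat \<Rightarrow> nat \<Rightarrow> 'k"

definition supp_sq :: "nat \<Rightarrow> 'k::zero sq set" where
  "supp_sq N = {X. \<forall>i j. (N \<le> i \<or> N \<le> j) \<longrightarrow> X i j = 0}"

definition mmul :: "nat \<Rightarrow> 'k::comm_semiring_1 sq \<Rightarrow> 'k sq \<Rightarrow> 'k sq" where
  "mmul N X Y = (\<lambda>i j. \<Sum>l<N. X i l * Y l j)"

definition munit :: "nat \<Rightarrow> 'k::comm_semiring_1 sq" where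
  "munit N = (\<lambda>i j. if i = j \<and> i < N then 1 else 0)"

definition msc :: "'k::times \<Rightarrow> 'k sq \<Rightarrow> 'k sq" where
  "msc c X = (\<lambda>i j. c * X i j)"

definition fd_alg :: "nat \<Rightarrow> 'k::field sq set \<Rightarrow> bool" where
  "fd_alg N A \<longleftrightarrow> A \<subseteq> supp_sq N \<and> 0 \<in> A \<and> munit N \<in> A \<and>
     (\<forall>X\<in>A. \<forall>Y\<in>A. X + Y \<in> A \<and> mmul N X Y \<in> A) \<and> (\<forall>c. \<forall>X\<in>A. msc c X \<in> A)"

definition idem :: "nat \<Rightarrow> 'k::field sq set \<Rightarrow> 'k sq \<Rightarrow> bool" where
  "idem N A e \<longleftrightarrow> e \<in> A \<and> mmul N e e = e"

definition primitive_idem :: "nat \<Rightarrow> 'k::field sq set \<Rightarrow> 'k sq \<Rightarrow> bool" where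
  "primitive_idem N A e \<longleftrightarrow> idem N A e \<and> e \<noteq> 0 \<and>
     (\<forall>e1 e2. idem N A e1 \<and> idem N A e2 \<and> mmul N e1 e2 = 0 \<and> mmul N e2 e1 = 0 \<and> e = e1 + e2
        \<longrightarrow> e1 = 0 \<or> e2 = 0)"

text \<open>B e and B e' are isomorphic left B-modules.  Hom_B(Be, Be') = eBe', where m in eBe'
acts by right multiplication x |-> x m.\<close>
definition proj_iso :: "nat \<Rightarrow> 'k::field sq set \<Rightarrow> 'k sq \<Rightarrow> 'k sq \<Rightarrow> bool" where
  "proj_iso N A e e' \<longleftrightarrow> (\<exists>a b. a \<in> A \<and> b \<in> A \<and> a = mmul N (mmul N e a) e' \<and>
      b = mmul N (mmul N e' b) e \<and> mmul N a b = e \<and> mmul N b a = e')"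

text \<open>E is a list of primitive idempotents such that B (E!i) runs through a complete
irredundant system of representatives of the isoclasses of indecomposable projective
B-modules.  These classes form the standard basis of K_0(proj B) = Z^(length E).\<close>
definition complete_reps :: "nat \<Rightarrow> 'k::field sq set \<Rightarrow> 'k sq list \<Rightarrow> bool" where
  "complete_reps N A E \<longleftrightarrow>
     (\<forall>i<length E. primitive_idem N A (E!i)) \<and>
     (\<forall>i<length E. \<forall>j<length E. i \<noteq> j \<longrightarrow> \<not> proj_iso N A (E!i) (E!j)) \<and>
     (\<forall>e. primitive_idem N A e \<longrightarrow> (\<exists>i<length E. proj_iso N A e (E!i)))"

text \<open>A list L of indices denotes the projective module (+)_s B (E!(L!s)).  A morphism
L -> M is a block matrix phi with phi s r in (E!(L!s)) B (E!(M!r)), zero outside the blocks.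
Composition is written diagrammatically: phi ; psi.\<close>

type_synonym 'k hm = "nat \<Rightarrow> nat \<Rightarrow> 'k sq"

definition homs :: "nat \<Rightarrow> 'k::field sq set \<Rightarrow> 'k sq list \<Rightarrow> nat list \<Rightarrow> nat list \<Rightarrow> 'k hm set" where
  "homs N A E L M = {\<phi>. \<forall>s r.
      (s < length L \<and> r < length M \<longrightarrow>
         \<phi> s r \<in> A \<and> \<phi> s r = mmul N (mmul N (E!(L!s)) (\<phi> s r)) (E!(M!r))) \<and>
      (\<not> (s < length L \<and> r < length M) \<longrightarrow> \<phi> s r = 0)}"

definition hcomp :: "nat \<Rightarrow> nat list \<Rightarrow> 'k::field hm \<Rightarrow> 'k hm \<Rightarrow> 'k hm" where
  "hcomp N M \<phi> \<psi> = (\<lambda>s t. \<Sum>r<length M. mmul N (\<phi> s r) (\<psi> r t))"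

definition hid :: "'k::field sq list \<Rightarrow> nat list \<Rightarrow> 'k hm" where
  "hid E L = (\<lambda>s r. if s < length L \<and> s = r then E!(L!s) else 0)"

text \<open>(L1, L0, f) is the complex L1 --f--> L0 in degrees -1, 0.\<close>
type_synonym 'k cplx = "nat list \<times> nat list \<times> 'k hm"

definition is_cplx :: "nat \<Rightarrow> 'k::field sq set \<Rightarrow> 'k sq list \<Rightarrow> 'k cplx \<Rightarrow> bool" where
  "is_cplx N A E X \<longleftrightarrow> (case X of (L1, L0, f) \<Rightarrow>
     set L1 \<subseteq> {..<length E} \<and> set L0 \<subseteq> {..<length E} \<and> f \<in> homs N A E L1 L0)"

definition zero_cplx :: "'k::zero cplx" where
  "zero_cplx = ([], [], (\<lambda>_ _. 0))"

definition chain_map :: "nat \<Rightarrow> 'k::field sq set \<Rightarrow> 'k sq list \<Rightarrow> 'k cplx \<Rightarrow> 'k cplx \<Rightarrow> ('k hm \<times> 'k hm) \<Rightarrow> bool" where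
  "chain_map N A E X Y a \<longleftrightarrow> (case X of (L1, L0, f) \<Rightarrow> case Y of (M1, M0, g) \<Rightarrow>
     fst a \<in> homs N A E L1 M1 \<and> snd a \<in> homs N A E L0 M0 \<and>
     hcomp N L0 f (snd a) = hcomp N M1 (fst a) g)"

definition homotopic :: "nat \<Rightarrow> 'k::field sq set \<Rightarrow> 'k sq list \<Rightarrow> 'k cplx \<Rightarrow> 'k cplx \<Rightarrow> ('k hm \<times> 'k hm) \<Rightarrow> ('k hm \<times> 'k hm) \<Rightarrow> bool" where
  "homotopic N A E X Y a b \<longleftrightarrow> (case X of (L1, L0, f) \<Rightarrow> case Y of (M1, M0, g) \<Rightarrow>
     (\<exists>h \<in> homs N A E L0 M1. fst a - fst b = hcomp N L0 f h \<and> snd a - snd b = hcomp N M1 h g))"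

definition ccomp :: "nat \<Rightarrow> 'k cplx \<Rightarrow> ('k::field hm \<times> 'k hm) \<Rightarrow> ('k hm \<times> 'k hm) \<Rightarrow> ('k hm \<times> 'k hm)" where
  "ccomp N Y a b = (case Y of (M1, M0, g) \<Rightarrow> (hcomp N M1 (fst a) (fst b), hcomp N M0 (snd a) (snd b)))"

definition cid :: "'k::field sq list \<Rightarrow> 'k cplx \<Rightarrow> ('k hm \<times> 'k hm)" where
  "cid E X = (case X of (L1, L0, f) \<Rightarrow> (hid E L1, hid E L0))"

definition kiso :: "nat \<Rightarrow> 'k::field sq set \<Rightarrow> 'k sq list \<Rightarrow> 'k cplx \<Rightarrow> 'k cplx \<Rightarrow> bool" where
  "kiso N A E X Y \<longleftrightarrow> (\<exists>a b. chain_map N A E X Y a \<and> chain_map N A E Y X b \<and>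
      homotopic N A E X X (ccomp N Y a b) (cid E X) \<and>
      homotopic N A E Y Y (ccomp N X b a) (cid E Y))"

definition dsum :: "'k::zero cplx \<Rightarrow> 'k cplx \<Rightarrow> 'k cplx" where
  "dsum X Y = (case X of (L1, L0, f) \<Rightarrow> case Y of (M1, M0, g) \<Rightarrow>
     (L1 @ M1, L0 @ M0, (\<lambda>s r. if s < length L1 \<and> r < length L0 then f s r
        else if length L1 \<le> s \<and> length L0 \<le> r then g (s - length L1) (r - length L0)
        else (\<lambda>_ _. 0))))"

definition dsums :: "'k::zero cplx list \<Rightarrow> 'k cplx" where
  "dsums Xs = foldr dsum Xs zero_cplx"

text \<open>Indecomposable object of K^b(proj B) (tested against decompositions into 2-term
complexes; direct summands of 2-term complexes are again 2-term).\<close>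
definition indec_cplx :: "nat \<Rightarrow> 'k::field sq set \<Rightarrow> 'k sq list \<Rightarrow> 'k cplx \<Rightarrow> bool" where
  "indec_cplx N A E X \<longleftrightarrow> is_cplx N A E X \<and> \<not> kiso N A E X zero_cplx \<and>
     (\<forall>Y Z. is_cplx N A E Y \<and> is_cplx N A E Z \<and> kiso N A E X (dsum Y Z)
        \<longrightarrow> kiso N A E Y zero_cplx \<or> kiso N A E Z zero_cplx)"

definition K0 :: "nat \<Rightarrow> (nat \<Rightarrow> int) set" where
  "K0 n = {\<theta>. \<forall>i\<ge>n. \<theta> i = 0}"

text \<open>theta = [P_0] - [P_1] with no common summands.\<close>
definition pos_list :: "nat \<Rightarrow> (nat \<Rightarrow> int) \<Rightarrow> nat list" where
  "pos_list n \<theta> = concat (map (\<lambda>i. replicate (nat (\<theta> i)) i) [0..<n])"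

definition neg_list :: "nat \<Rightarrow> (nat \<Rightarrow> int) \<Rightarrow> nat list" where
  "neg_list n \<theta> = concat (map (\<lambda>i. replicate (nat (- \<theta> i)) i) [0..<n])"

definition Hom\<theta> :: "nat \<Rightarrow> 'k::field sq set \<Rightarrow> 'k sq list \<Rightarrow> (nat \<Rightarrow> int) \<Rightarrow> 'k hm set" where
  "Hom\<theta> N A E \<theta> = homs N A E (neg_list (length E) \<theta>) (pos_list (length E) \<theta>)"

definition Pf :: "'k sq list \<Rightarrow> (nat \<Rightarrow> int) \<Rightarrow> 'k hm \<Rightarrow> 'k cplx" where
  "Pf E \<theta> f = (neg_list (length E) \<theta>, pos_list (length E) \<theta>, f)"

inductive_set polyfun :: "('k::field hm \<Rightarrow> 'k) set" where
  pf_const: "(\<lambda>_. c) \<in> polyfun"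
| pf_coord: "(\<lambda>\<phi>. \<phi> s r i j) \<in> polyfun"
| pf_add: "p \<in> polyfun \<Longrightarrow> q \<in> polyfun \<Longrightarrow> (\<lambda>\<phi>. p \<phi> + q \<phi>) \<in> polyfun"
| pf_mult: "p \<in> polyfun \<Longrightarrow> q \<in> polyfun \<Longrightarrow> (\<lambda>\<phi>. p \<phi> * q \<phi>) \<in> polyfun"

definition zariski_open :: "'k::field hm set \<Rightarrow> 'k hm set \<Rightarrow> bool" where
  "zariski_open V U \<longleftrightarrow> (\<exists>F. finite F \<and> F \<subseteq> polyfun \<and> U = {\<phi>\<in>V. \<exists>p\<in>F. p \<phi> \<noteq> 0})"

definition zariski_dense :: "'k::field hm set \<Rightarrow> 'k hm set \<Rightarrow> bool" where
  "zariski_dense V U \<longleftrightarrow> (\<forall>W. zariski_open V W \<and> W \<noteq> {} \<longrightarrow> W \<inter> U \<noteq> {})"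

definition general :: "'k::field hm set \<Rightarrow> ('k hm \<Rightarrow> bool) \<Rightarrow> bool" where
  "general V P \<longleftrightarrow> (\<exists>U. zariski_open V U \<and> U \<noteq> {} \<and> zariski_dense V U \<and> (\<forall>f\<in>U. P f))"

definition indec_elt :: "nat \<Rightarrow> 'k::field sq set \<Rightarrow> 'k sq list \<Rightarrow> (nat \<Rightarrow> int) \<Rightarrow> bool" where
  "indec_elt N A E \<theta> \<longleftrightarrow> general (Hom\<theta> N A E \<theta>) (\<lambda>f. indec_cplx N A E (Pf E \<theta> f))"

text \<open>Hom_{K^b}(P_f, P_g[1]) is nonzero: Hom(P_1,P_0) modulo the null-homotopic maps
f ; Hom(P_0,P_0) + Hom(P_1,P_1) ; g is nonzero.\<close>
definition hom_shift_nonzero :: "nat \<Rightarrow> 'k::field sq set \<Rightarrow> 'k sq list \<Rightarrow> (nat \<Rightarrow> int) \<Rightarrow> 'k hm \<Rightarrow> 'k hm \<Rightarrow> bool" where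
  "hom_shift_nonzero N A E \<theta> f g \<longleftrightarrow>
     (let P1 = neg_list (length E) \<theta>; P0 = pos_list (length E) \<theta> in
      \<exists>h \<in> homs N A E P1 P0. \<not> (\<exists>s0 \<in> homs N A E P0 P0. \<exists>s1 \<in> homs N A E P1 P1.
          h = hcomp N P0 f s0 + hcomp N P1 s1 g))"

text \<open>min over f, g in Hom(theta) of dim Hom(P_f, P_g[1]) is nonzero.\<close>
definition wild :: "nat \<Rightarrow> 'k::field sq set \<Rightarrow> 'k sq list \<Rightarrow> (nat \<Rightarrow> int) \<Rightarrow> bool" where
  "wild N A E \<theta> \<longleftrightarrow> (\<forall>f\<in>Hom\<theta> N A E \<theta>. \<forall>g\<in>Hom\<theta> N A E \<theta>. hom_shift_nonzero N A E \<theta> f g)"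

definition canon_decomp :: "nat \<Rightarrow> 'k::field sq set \<Rightarrow> 'k sq list \<Rightarrow> (nat \<Rightarrow> int) \<Rightarrow> (nat \<Rightarrow> int) list \<Rightarrow> bool" where
  "canon_decomp N A E \<theta> ts \<longleftrightarrow>
     \<theta> = sum_list ts \<and>
     (\<forall>t\<in>set ts. t \<in> K0 (length E) \<and> indec_elt N A E t) \<and>
     general (Hom\<theta> N A E \<theta>) (\<lambda>f. \<exists>fs. length fs = length ts \<and>
        (\<forall>i<length ts. fs!i \<in> Hom\<theta> N A E (ts!i)) \<and>
        kiso N A E (Pf E \<theta> f) (dsums (map (\<lambda>i. Pf E (ts!i) (fs!i)) [0..<length ts])))"

definition ind :: "nat \<Rightarrow> 'k::field sq set \<Rightarrow> 'k sq list \<Rightarrow> (nat \<Rightarrow> int) \<Rightarrow> (nat \<Rightarrow> int) set" where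
  "ind N A E \<theta> = {t. \<exists>ts. canon_decomp N A E \<theta> ts \<and> t \<in> set ts}"

definition indN :: "nat \<Rightarrow> 'k::field sq set \<Rightarrow> 'k sq list \<Rightarrow> (nat \<Rightarrow> int) \<Rightarrow> (nat \<Rightarrow> int) set" where
  "indN N A E \<theta> = (\<Union>l\<in>{1::nat..}. ind N A E (\<lambda>i. int l * \<theta> i))"

definition cone :: "(nat \<Rightarrow> int) set \<Rightarrow> (nat \<Rightarrow> real) set" where
  "cone X = {v. \<exists>S c. finite S \<and> S \<subseteq> X \<and> (\<forall>x\<in>S. c x \<ge> (0::real)) \<and>
      v = (\<lambda>i. \<Sum>x\<in>S. c x * real_of_int (x i))}"

end

theory Submission
  imports Defs "HOL-Library.Product_Plus"
begin

text \<open>Let \<open>X\<close>, \<open>Y\<close>, \<open>Z\<close> be three projectives with \<open>Hom(X, Y) = V\<close>, \<open>Hom(Y, Z) = W\<close> and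
\<open>Hom(X, Z) = U\<close> all of dimension 3, composition being the cross product, and let
\<open>\<theta> = [Y] + [Z] - [X]\<close>. A skew \<open>3 \<times> 3\<close> matrix is singular: for \<open>v \<in> V\<close> the map \<open>v \<times> _ : W \<rightarrow> U\<close>
is not onto, so a general \<open>(v, u) : X \<rightarrow> Y \<oplus> Z\<close> cannot be simplified and is indecomposable. For
\<open>2\<theta>\<close>, however, a general \<open>2 \<times> 2\<close> matrix over \<open>V\<close> gives an invertible map \<open>W\<^sup>2 \<rightarrow> U\<^sup>2\<close> (a \<open>6 \<times> 6\<close>
matrix), so the component in \<open>Z\<^sup>2\<close> can be cleared, and \<open>2\<theta>\<close> decomposes as
\<open>(2[Y] - 2[X]) \<oplus> [Z] \<oplus> [Z]\<close>.\<close>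

section \<open>Complexes of projectives\<close>

text \<open>Doubling helps because 2x2 matrices do not commute. Let A0, A1, A2 be the coordinates of
  the component in V: scalars for \<theta>, 2x2 matrices for 2\<theta>. If A0 has an inverse I,
  elimination reduces the map from W to U to A1 I A2 - A2 I A1, which is 0 for scalars but
  generically invertible for 2x2 matrices. The same expression governs 2[Y] - 2[X]: an endomorphism
  amounts to a matrix commuting with A1 I and A2 I, and only scalars commute with two 2x2 matrices
  that do not commute with each other.

  Indecomposability is handled without Krull-Schmidt. In the complexes tested, no nonzero map leads
  from degree 0 back to degree -1, so homotopic endomorphisms are equal and it suffices that 0 and 1
  are the only idempotent chain maps. As \<open>ind\<close> collects the members of all canonical
  decompositions, it must also be shown that an indecomposable class has only the trivial one; the
  absence of oriented cycles enters there, to exclude contractible summands. So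
  \<open>cone (ind \<theta>)\<close> lies on the line through \<theta>, and [Z], found in 2\<theta>,
  lies off it.\<close>

lemma sum_fun_apply: "(\<Sum>x\<in>S. f x) i = (\<Sum>x\<in>S. f x i)"
  by (induction S rule: infinite_finite_induct) auto

lemma mmul_assoc: "mmul N (mmul N X Y) Z = mmul N X (mmul N Y Z)"
  unfolding mmul_def
  by (intro ext) (simp add: sum_distrib_left sum_distrib_right mult.assoc, rule sum.swap)

lemma mmul_add_left: "mmul N (X + Y) Z = mmul N X Z + mmul N Y Z"
  and mmul_add_right: "mmul N X (Y + Z) = mmul N X Y + mmul N X Z"
  by (auto simp: mmul_def fun_eq_iff distrib_left distrib_right sum.distrib)

lemma mmul_diff_left: "mmul N (X - Y) (Z :: 'k::comm_ring_1 sq) = mmul N X Z - mmul N Y Z"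
  and mmul_diff_right: "mmul N X (Y - Z :: 'k::comm_ring_1 sq) = mmul N X Y - mmul N X Z"
  by (auto simp: mmul_def fun_eq_iff left_diff_distrib right_diff_distrib sum_subtractf)

lemma mmul_zero_left [simp]: "mmul N 0 Z = 0"
  and mmul_zero_right [simp]: "mmul N Z 0 = 0"
  by (auto simp: mmul_def fun_eq_iff)

lemma mmul_sum_left: "mmul N (\<Sum>x\<in>S. f x) Z = (\<Sum>x\<in>S. mmul N (f x) Z)"
  unfolding mmul_def
  by (intro ext) (simp add: sum_fun_apply sum_distrib_right, rule sum.swap)

lemma mmul_sum_right: "mmul N Z (\<Sum>x\<in>S. f x) = (\<Sum>x\<in>S. mmul N Z (f x))"
  unfolding mmul_def
  by (intro ext) (simp add: sum_fun_apply sum_distrib_left, rule sum.swap)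

lemma hcomp_assoc: "hcomp N M2 (hcomp N M1 f g) h = hcomp N M1 f (hcomp N M2 g h)"
  unfolding hcomp_def
  by (intro ext) (simp add: mmul_sum_left mmul_sum_right mmul_assoc sum_fun_apply, rule sum.swap)

lemma hcomp_add_left: "hcomp N M (f + g) h = hcomp N M f h + hcomp N M g h"
  and hcomp_add_right: "hcomp N M f (g + h) = hcomp N M f g + hcomp N M f h"
  by (auto simp: hcomp_def fun_eq_iff mmul_add_left mmul_add_right sum.distrib)

lemma hcomp_diff_left: "hcomp N M (f - g) h = hcomp N M f h - hcomp N M g h"
  and hcomp_diff_right: "hcomp N M f (g - h) = hcomp N M f g - hcomp N M f h"
  by (auto simp: hcomp_def fun_eq_iff mmul_diff_left mmul_diff_right sum_subtractf)

lemma hcomp_zero_left [simp]: "hcomp N M 0 h = 0"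
  and hcomp_zero_right [simp]: "hcomp N M h 0 = 0"
  by (auto simp: hcomp_def fun_eq_iff sum_fun_apply)

lemma ccomp_assoc: "ccomp N Z (ccomp N Y a b) c = ccomp N Y a (ccomp N Z b c)"
  by (auto simp: ccomp_def hcomp_assoc split: prod.splits)

lemma ccomp_add_left: "ccomp N Y (a + b) c = ccomp N Y a c + ccomp N Y b c"
  and ccomp_add_right: "ccomp N Y a (b + c) = ccomp N Y a b + ccomp N Y a c"
  and ccomp_diff_left: "ccomp N Y (a - b) c = ccomp N Y a c - ccomp N Y b c"
  and ccomp_diff_right: "ccomp N Y a (b - c) = ccomp N Y a b - ccomp N Y a c"
  by (auto simp: ccomp_def hcomp_add_left hcomp_add_right hcomp_diff_left hcomp_diff_right
      plus_prod_def minus_prod_def split: prod.splits)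

lemma ccomp_zero_left [simp]: "ccomp N Y 0 c = 0"
  and ccomp_zero_right [simp]: "ccomp N Y c 0 = 0"
  by (auto simp: ccomp_def zero_prod_def split: prod.splits)

section \<open>Null-homotopic maps and contractible complexes\<close>

definition null :: "nat \<Rightarrow> 'k::field sq set \<Rightarrow> 'k sq list \<Rightarrow> 'k cplx \<Rightarrow> 'k cplx \<Rightarrow> ('k hm \<times> 'k hm) \<Rightarrow> bool" where
  "null N A E X Y a \<longleftrightarrow> homotopic N A E X Y a 0"

lemma null_alt: "null N A E (L1, L0, f) (M1, M0, g) a \<longleftrightarrow>
  (\<exists>h \<in> homs N A E L0 M1. a = (hcomp N L0 f h, hcomp N M1 h g))"
  unfolding null_def homotopic_def by (simp add: prod_eq_iff)

lemma homotopic_iff_null: "homotopic N A E X Y a b \<longleftrightarrow> null N A E X Y (a - b)"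
  by (auto simp: null_def homotopic_def split: prod.splits)

definition contractible :: "nat \<Rightarrow> 'k::field sq set \<Rightarrow> 'k sq list \<Rightarrow> 'k cplx \<Rightarrow> bool" where
  "contractible N A E X \<longleftrightarrow> null N A E X X (cid E X)"

text \<open>As functions on indices, the inclusion of and the projection onto the first summand of
\<open>L @ M\<close> are both \<open>hid E L\<close>.\<close>

definition cinr :: "'k::field sq list \<Rightarrow> nat list \<Rightarrow> nat list \<Rightarrow> 'k hm" where
  "cinr E L M = (\<lambda>s r. if s < length M \<and> r = length L + s then E ! (M ! s) else 0)"

definition cprr :: "'k::field sq list \<Rightarrow> nat list \<Rightarrow> nat list \<Rightarrow> 'k hm" where
  "cprr E L M = (\<lambda>s r. if r < length M \<and> s = length L + r then E ! (M ! r) else 0)"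

lemma homsD:
  assumes "\<phi> \<in> homs N A E L M"
  shows "s < length L \<Longrightarrow> r < length M \<Longrightarrow> \<phi> s r \<in> A"
    and "s < length L \<Longrightarrow> r < length M \<Longrightarrow> mmul N (mmul N (E!(L!s)) (\<phi> s r)) (E!(M!r)) = \<phi> s r"
    and "\<not> (s < length L \<and> r < length M) \<Longrightarrow> \<phi> s r = 0"
  using assms unfolding homs_def mem_Collect_eq by (metis, metis, metis)

lemma homsI:
  assumes "\<And>s r. s < length L \<Longrightarrow> r < length M \<Longrightarrow> \<phi> s r \<in> A"
    and "\<And>s r. s < length L \<Longrightarrow> r < length M \<Longrightarrow> mmul N (mmul N (E!(L!s)) (\<phi> s r)) (E!(M!r)) = \<phi> s r"
    and "\<And>s r. \<not> (s < length L \<and> r < length M) \<Longrightarrow> \<phi> s r = 0"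
  shows "\<phi> \<in> homs N A E L M"
  using assms unfolding homs_def by auto

locale projectives =
  fixes N :: nat and A :: "'k::field sq set" and E :: "'k sq list"
  assumes alg: "fd_alg N A" and idems: "i < length E \<Longrightarrow> idem N A (E ! i)"
begin

definition valid :: "nat list \<Rightarrow> bool" where
  "valid L \<longleftrightarrow> set L \<subseteq> {..<length E}"

lemma valid_append [simp]: "valid (L @ M) \<longleftrightarrow> valid L \<and> valid M"
  by (auto simp: valid_def)

lemma valid_nth: "valid L \<Longrightarrow> s < length L \<Longrightarrow> L ! s < length E"
  by (auto simp: valid_def subset_iff)

lemma zero_A: "0 \<in> A" and add_A: "X \<in> A \<Longrightarrow> Y \<in> A \<Longrightarrow> X + Y \<in> A"
  and mmul_A: "X \<in> A \<Longrightarrow> Y \<in> A \<Longrightarrow> mmul N X Y \<in> A"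
  using alg by (auto simp: fd_alg_def)

lemma diff_A:
  assumes "X \<in> A" "Y \<in> A"
  shows "X - Y \<in> A"
proof -
  have "X + msc (-1) Y \<in> A"
    using alg assms by (auto simp: fd_alg_def)
  moreover have "X + msc (-1) Y = X - Y"
    by (auto simp: msc_def fun_eq_iff)
  ultimately show ?thesis by simp
qed

lemma sum_A: "(\<And>x. x \<in> S \<Longrightarrow> f x \<in> A) \<Longrightarrow> sum f S \<in> A"
  by (induction S rule: infinite_finite_induct) (auto simp: zero_A add_A)

lemma E_A: "i < length E \<Longrightarrow> E ! i \<in> A" and E_idem: "i < length E \<Longrightarrow> mmul N (E ! i) (E ! i) = E ! i"
  using idems by (auto simp: idem_def)

lemma homs_left:
  assumes "\<phi> \<in> homs N A E L M" "valid L" "s < length L"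
  shows "mmul N (E ! (L ! s)) (\<phi> s r) = \<phi> s r"
proof (cases "r < length M")
  case True
  have "mmul N (E ! (L ! s)) (\<phi> s r) = mmul N (E ! (L ! s)) (mmul N (mmul N (E!(L!s)) (\<phi> s r)) (E!(M!r)))"
    using homsD(2)[OF assms(1,3) True] by simp
  also have "\<dots> = mmul N (mmul N (mmul N (E ! (L ! s)) (E!(L!s))) (\<phi> s r)) (E!(M!r))"
    by (simp add: mmul_assoc)
  finally show ?thesis
    using E_idem[OF valid_nth] assms homsD(2)[OF assms(1,3) True] by simp
qed (use homsD(3)[OF assms(1)] in auto)

lemma homs_right:
  assumes "\<phi> \<in> homs N A E L M" "valid M" "r < length M"
  shows "mmul N (\<phi> s r) (E ! (M ! r)) = \<phi> s r"
proof (cases "s < length L")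
  case True
  have "mmul N (\<phi> s r) (E ! (M ! r)) = mmul N (mmul N (mmul N (E!(L!s)) (\<phi> s r)) (E!(M!r))) (E ! (M ! r))"
    using homsD(2)[OF assms(1) True assms(3)] by simp
  also have "\<dots> = mmul N (mmul N (E!(L!s)) (\<phi> s r)) (mmul N (E!(M!r)) (E ! (M ! r)))"
    by (simp add: mmul_assoc)
  finally show ?thesis
    using E_idem[OF valid_nth] assms homsD(2)[OF assms(1) True assms(3)] by simp
qed (use homsD(3)[OF assms(1)] in auto)

lemma homs_zero: "0 \<in> homs N A E L M"
  by (rule homsI) (auto simp: zero_A)

lemma homs_add: "\<phi> \<in> homs N A E L M \<Longrightarrow> \<psi> \<in> homs N A E L M \<Longrightarrow> \<phi> + \<psi> \<in> homs N A E L M"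
  by (rule homsI) (simp_all add: add_A homsD(1,2) mmul_add_left mmul_add_right homsD(3) fun_eq_iff)

lemma homs_diff: "\<phi> \<in> homs N A E L M \<Longrightarrow> \<psi> \<in> homs N A E L M \<Longrightarrow> \<phi> - \<psi> \<in> homs N A E L M"
  by (rule homsI) (simp_all add: diff_A homsD(1,2) mmul_diff_left mmul_diff_right homsD(3))

lemma homs_hcomp:
  assumes f: "f \<in> homs N A E L M" and g: "g \<in> homs N A E M K" and "valid L" "valid K"
  shows "hcomp N M f g \<in> homs N A E L K"
proof (rule homsI)
  fix s r assume sr: "s < length L" "r < length K"
  show "hcomp N M f g s r \<in> A"
    unfolding hcomp_def using sr f g by (intro sum_A mmul_A) (auto simp: homsD)
  have "mmul N (mmul N (E ! (L ! s)) (mmul N (f s t) (g t r))) (E ! (K ! r)) =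
      mmul N (mmul N (E ! (L ! s)) (f s t)) (mmul N (g t r) (E ! (K ! r)))" for t
    by (simp add: mmul_assoc)
  then show "mmul N (mmul N (E ! (L ! s)) (hcomp N M f g s r)) (E ! (K ! r)) = hcomp N M f g s r"
    unfolding hcomp_def mmul_sum_left mmul_sum_right
    using homs_left[OF f] homs_right[OF g] assms sr by simp
next
  fix s r assume "\<not> (s < length L \<and> r < length K)"
  then have "mmul N (f s t) (g t r) = 0" for t
    using homsD(3)[OF f, of s t] homsD(3)[OF g, of t r] by auto
  then show "hcomp N M f g s r = 0"
    by (simp add: hcomp_def)
qed

lemma hid_homs:
  assumes "valid L"
  shows "hid E L \<in> homs N A E L L" "hid E L \<in> homs N A E L (L @ M)" "hid E L \<in> homs N A E (L @ M) L"
  using assms by (auto intro!: homsI simp: hid_def nth_append E_A valid_nth zero_A E_idem split: if_splits)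

lemma cinr_homs: "valid M \<Longrightarrow> cinr E L M \<in> homs N A E M (L @ M)"
  and cprr_homs: "valid M \<Longrightarrow> cprr E L M \<in> homs N A E (L @ M) M"
  by (auto intro!: homsI simp: cinr_def cprr_def nth_append E_A valid_nth zero_A E_idem split: if_splits)

lemma hcomp_hid_left:
  assumes "f \<in> homs N A E L M" "valid L"
  shows "hcomp N L (hid E L) f = f"
proof (intro ext)
  fix s r i j
  have "hcomp N L (hid E L) f s r = (\<Sum>t<length L. if t = s then f s r else 0)"
    unfolding hcomp_def using homs_left[OF assms] by (intro sum.cong) (auto simp: hid_def)
  also have "\<dots> = f s r"
    using homsD(3)[OF assms(1), of s r] by auto
  finally show "hcomp N L (hid E L) f s r i j = f s r i j" by simp
qed

lemma hcomp_hid_right: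
  assumes "f \<in> homs N A E L M" "valid M"
  shows "hcomp N M f (hid E M) = f"
proof (intro ext)
  fix s r i j
  have "hcomp N M f (hid E M) s r = (\<Sum>t<length M. if t = r then f s r else 0)"
    unfolding hcomp_def using homs_right[OF assms] by (intro sum.cong) (auto simp: hid_def)
  also have "\<dots> = f s r"
    using homsD(3)[OF assms(1), of s r] by auto
  finally show "hcomp N M f (hid E M) s r i j = f s r i j" by simp
qed

lemma is_cplx_alt: "is_cplx N A E (L1, L0, f) \<longleftrightarrow> valid L1 \<and> valid L0 \<and> f \<in> homs N A E L1 L0"
  by (simp add: is_cplx_def valid_def)

lemma chain_map_ccomp:
  assumes "is_cplx N A E X" "is_cplx N A E Y" "is_cplx N A E Z"
    and "chain_map N A E X Y a" "chain_map N A E Y Z b"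
  shows "chain_map N A E X Z (ccomp N Y a b)"
proof -
  obtain L1 L0 f where X: "X = (L1, L0, f)" by (cases X)
  obtain M1 M0 g where Y: "Y = (M1, M0, g)" by (cases Y)
  obtain K1 K0 k where Z: "Z = (K1, K0, k)" by (cases Z)
  have "hcomp N L0 f (hcomp N M0 (snd a) (snd b)) = hcomp N M0 (hcomp N L0 f (snd a)) (snd b)"
    by (simp add: hcomp_assoc)
  also have "\<dots> = hcomp N M1 (fst a) (hcomp N M0 g (snd b))"
    using assms(4) by (simp add: X Y chain_map_def hcomp_assoc)
  also have "\<dots> = hcomp N K1 (hcomp N M1 (fst a) (fst b)) k"
    using assms(5) by (simp add: Y Z chain_map_def hcomp_assoc)
  finally show ?thesis
    using assms by (auto simp: X Y Z chain_map_def ccomp_def is_cplx_alt intro!: homs_hcomp)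
qed

lemma ccomp_cid_left: "is_cplx N A E X \<Longrightarrow> chain_map N A E X Y a \<Longrightarrow> ccomp N X (cid E X) a = a"
  by (cases X; cases Y; cases a) (auto simp: ccomp_def chain_map_def cid_def is_cplx_alt hcomp_hid_left)

lemma ccomp_cid_right: "is_cplx N A E Y \<Longrightarrow> chain_map N A E X Y a \<Longrightarrow> ccomp N Y a (cid E Y) = a"
  by (cases X; cases Y; cases a) (auto simp: ccomp_def chain_map_def cid_def is_cplx_alt hcomp_hid_right)

text \<open>The homotopy of \<open>a\<close> followed by the degree -1 component of \<open>b\<close>
  is a homotopy of the composite. Together with \<open>null_ccomp_right\<close> this makes the null
  maps a two-sided ideal, so that computing modulo them is computing in the homotopy
  category.\<close>

lemma null_ccomp_left:
  assumes "is_cplx N A E X" "is_cplx N A E Y" "is_cplx N A E Z"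
    and "null N A E X Y a" "chain_map N A E Y Z b"
  shows "null N A E X Z (ccomp N Y a b)"
proof -
  obtain L1 L0 f where X: "X = (L1, L0, f)" by (cases X)
  obtain M1 M0 g where Y: "Y = (M1, M0, g)" by (cases Y)
  obtain K1 K0 k where Z: "Z = (K1, K0, k)" by (cases Z)
  obtain h where h: "h \<in> homs N A E L0 M1" "a = (hcomp N L0 f h, hcomp N M1 h g)"
    using assms(4) by (auto simp: X Y null_alt)
  have "hcomp N M1 h (fst b) \<in> homs N A E L0 K1"
    using assms h by (auto simp: X Y Z chain_map_def is_cplx_alt intro: homs_hcomp)
  moreover have "ccomp N Y a b = (hcomp N L0 f (hcomp N M1 h (fst b)), hcomp N K1 (hcomp N M1 h (fst b)) k)"
    using assms(5) h by (auto simp: Y Z ccomp_def chain_map_def hcomp_assoc)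
  ultimately show ?thesis
    by (auto simp: X Z null_alt)
qed

lemma null_ccomp_right:
  assumes "is_cplx N A E X" "is_cplx N A E Y" "is_cplx N A E Z"
    and "chain_map N A E X Y a" "null N A E Y Z b"
  shows "null N A E X Z (ccomp N Y a b)"
proof -
  obtain L1 L0 f where X: "X = (L1, L0, f)" by (cases X)
  obtain M1 M0 g where Y: "Y = (M1, M0, g)" by (cases Y)
  obtain K1 K0 k where Z: "Z = (K1, K0, k)" by (cases Z)
  obtain h where h: "h \<in> homs N A E M0 K1" "b = (hcomp N M0 g h, hcomp N K1 h k)"
    using assms(5) by (auto simp: Y Z null_alt)
  have "hcomp N M0 (snd a) h \<in> homs N A E L0 K1"
    using assms h by (auto simp: X Y Z chain_map_def is_cplx_alt intro: homs_hcomp)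
  moreover have "ccomp N Y a b = (hcomp N L0 f (hcomp N M0 (snd a) h), hcomp N K1 (hcomp N M0 (snd a) h) k)"
    using assms(4) h by (auto simp: X Y ccomp_def chain_map_def simp flip: hcomp_assoc)
  ultimately show ?thesis
    by (auto simp: X Z null_alt)
qed

lemma null_zero: "null N A E X Y 0"
  by (cases X; cases Y) (auto simp: null_alt zero_prod_def homs_zero intro!: bexI[of _ 0])

lemma null_add: "null N A E X Y a \<Longrightarrow> null N A E X Y b \<Longrightarrow> null N A E X Y (a + b)"
  apply (cases X; cases Y)
  apply (clarsimp simp: null_alt plus_prod_def)
  subgoal for _ _ _ _ _ _ h h'
    by (rule bexI[of _ "h + h'"]) (auto simp: hcomp_add_left hcomp_add_right homs_add)
  done

lemma null_diff: "null N A E X Y a \<Longrightarrow> null N A E X Y b \<Longrightarrow> null N A E X Y (a - b)"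
  apply (cases X; cases Y)
  apply (clarsimp simp: null_alt minus_prod_def)
  subgoal for _ _ _ _ _ _ h h'
    by (rule bexI[of _ "h - h'"]) (auto simp: hcomp_diff_left hcomp_diff_right homs_diff)
  done

lemma is_cplx_zero_cplx: "is_cplx N A E zero_cplx"
  by (auto simp: zero_cplx_def is_cplx_alt valid_def zero_fun_def[symmetric] homs_zero)

lemma cid_zero_cplx: "cid E zero_cplx = 0"
  by (auto simp: zero_cplx_def cid_def hid_def zero_prod_def fun_eq_iff)

lemma chain_map_zero: "chain_map N A E X Y 0"
  by (auto simp: chain_map_def homs_zero split: prod.splits)

lemma ccomp_zero_cplx: "ccomp N zero_cplx a b = 0"
  by (auto simp: zero_cplx_def ccomp_def hcomp_def zero_prod_def fun_eq_iff)

lemma null_minus_iff: "null N A E X Y (0 - a) \<longleftrightarrow> null N A E X Y a"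
  using null_diff[OF null_zero, of X Y "0 - a"] null_diff[OF null_zero, of X Y a] by auto

text \<open>Whatever factors through \<open>zero_cplx\<close> is 0, so all that remains of an
  isomorphism with it is a null homotopy of the identity of \<open>X\<close>.\<close>

lemma kiso_zero_cplx: "kiso N A E X zero_cplx \<longleftrightarrow> contractible N A E X"
proof
  assume "kiso N A E X zero_cplx"
  then have "null N A E X X (0 - cid E X)"
    by (auto simp: kiso_def homotopic_iff_null ccomp_zero_cplx)
  then show "contractible N A E X"
    by (simp only: null_minus_iff contractible_def)
next
  assume "contractible N A E X"
  then have "null N A E X X (0 - cid E X)"
    by (simp only: null_minus_iff contractible_def)
  then show "kiso N A E X zero_cplx"
    unfolding kiso_def homotopic_iff_null
    by (intro exI[of _ 0]) (auto simp: chain_map_zero cid_zero_cplx null_zero)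
qed

text \<open>The splitting is strict, not only up to homotopy; the inclusions and projections of
  \<open>dsum\<close> provide this.\<close>

definition retraction :: "'k cplx \<Rightarrow> 'k cplx \<Rightarrow> ('k hm \<times> 'k hm) \<Rightarrow> ('k hm \<times> 'k hm) \<Rightarrow> bool" where
  "retraction Y W i p \<longleftrightarrow> is_cplx N A E Y \<and> is_cplx N A E W \<and> chain_map N A E Y W i \<and> chain_map N A E W Y p \<and>
     ccomp N W i p = cid E Y"

lemma contractible_retract:
  assumes "retraction Y W i p" "contractible N A E W"
  shows "contractible N A E Y"
proof -
  note r = assms(1)[unfolded retraction_def]
  have "null N A E Y Y (ccomp N W (ccomp N W i (cid E W)) p)"
    using r assms(2) unfolding contractible_def
    by (meson null_ccomp_left null_ccomp_right)
  then show ?thesis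
    using r ccomp_cid_right[of W Y i] by (simp add: contractible_def)
qed

text \<open>If the idempotent of \<open>X\<close> belonging to the summand \<open>Y\<close> vanishes, then so does the
identity of \<open>Y\<close>, being conjugate to it up to homotopy.\<close>

lemma contractible_summand:
  assumes r: "retraction Y W i p" and X: "is_cplx N A E X"
    and a: "chain_map N A E X W a" and b: "chain_map N A E W X b"
    and ba: "null N A E W W (ccomp N X b a - cid E W)"
    and e: "ccomp N W a (ccomp N Y p (ccomp N W i b)) = 0"
  shows "contractible N A E Y"
proof -
  note r' = r[unfolded retraction_def]
  \<comment> \<open>Up to homotopy \<open>c\<close> is the identity of \<open>Y\<close>, since
    \<open>b\<close> followed by \<open>a\<close> is that of \<open>W\<close>. But the square of
    \<open>c\<close> contains the composite assumed to vanish, so the identity is homotopic to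
    0.\<close>
  define c where "c = ccomp N W i (ccomp N X b (ccomp N W a p))"
  have Y: "is_cplx N A E Y" and W: "is_cplx N A E W" and i: "chain_map N A E Y W i"
    and p: "chain_map N A E W Y p" and ip: "ccomp N W i p = cid E Y"
    using r' by auto
  have c: "chain_map N A E Y Y c"
    unfolding c_def using Y W X i p a b by (meson chain_map_ccomp)
  have "ccomp N W i (ccomp N W (ccomp N X b a - cid E W) p) = c - cid E Y"
    unfolding c_def using W p ip
    by (simp add: ccomp_diff_left ccomp_diff_right ccomp_assoc ccomp_cid_left)
  moreover have "null N A E Y Y (ccomp N W i (ccomp N W (ccomp N X b a - cid E W) p))"
    using ba Y W i p by (meson null_ccomp_left null_ccomp_right)
  ultimately have n: "null N A E Y Y (c - cid E Y)" by simp
  have "ccomp N Y c c = ccomp N W i (ccomp N X b (ccomp N X (ccomp N W a (ccomp N Y p (ccomp N W i b))) (ccomp N W a p)))"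
    unfolding c_def by (simp add: ccomp_assoc)
  then have cc: "ccomp N Y c c = 0"
    by (simp add: e)
  have "null N A E Y Y (ccomp N Y (c - cid E Y) c + (c - cid E Y))"
    using n c Y by (intro null_add null_ccomp_left)
  moreover have "ccomp N Y (c - cid E Y) c + (c - cid E Y) = 0 - cid E Y"
    using cc c Y by (simp add: ccomp_diff_left ccomp_cid_left)
  ultimately have "null N A E Y Y (0 - cid E Y)"
    by (simp only:)
  then show ?thesis
    unfolding contractible_def null_minus_iff .
qed

end

section \<open>Direct sums and indecomposable complexes\<close>

context projectives
begin

text \<open>Only the summand with index \<open>s\<close> survives. \<open>K\<close> may be longer
  than \<open>L\<close> because \<open>hid E L\<close> also serves as inclusion into and projection
  from \<open>L @ M\<close>.\<close>

lemma hcomp_hid_left_apply: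
  assumes "length L \<le> length K"
  shows "hcomp N K (hid E L) G s r = (if s < length L then mmul N (E ! (L ! s)) (G s r) else 0)"
proof -
  have "hcomp N K (hid E L) G s r = (\<Sum>t<length K. if t = s then (if s < length L then mmul N (E ! (L ! s)) (G s r) else 0) else 0)"
    unfolding hcomp_def by (intro sum.cong) (auto simp: hid_def)
  then show ?thesis using assms by auto
qed

lemma hcomp_hid_right_apply:
  assumes "length L \<le> length K"
  shows "hcomp N K G (hid E L) s r = (if r < length L then mmul N (G s r) (E ! (L ! r)) else 0)"
proof -
  have "hcomp N K G (hid E L) s r = (\<Sum>t<length K. if t = r then (if r < length L then mmul N (G s r) (E ! (L ! r)) else 0) else 0)"
    unfolding hcomp_def by (intro sum.cong) (auto simp: hid_def)
  then show ?thesis using assms by auto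
qed

lemma hcomp_cinr_left_apply:
  "hcomp N (L @ M) (cinr E L M) G s r = (if s < length M then mmul N (E ! (M ! s)) (G (length L + s) r) else 0)"
proof -
  have "hcomp N (L @ M) (cinr E L M) G s r = (\<Sum>t<length (L @ M). if t = length L + s then
      (if s < length M then mmul N (E ! (M ! s)) (G (length L + s) r) else 0) else 0)"
    unfolding hcomp_def by (intro sum.cong) (auto simp: cinr_def)
  then show ?thesis by auto
qed

lemma hcomp_cprr_right_apply:
  "hcomp N (L @ M) G (cprr E L M) s r = (if r < length M then mmul N (G s (length L + r)) (E ! (M ! r)) else 0)"
proof -
  have "hcomp N (L @ M) G (cprr E L M) s r = (\<Sum>t<length (L @ M). if t = length L + r then
      (if r < length M then mmul N (G s (length L + r)) (E ! (M ! r)) else 0) else 0)"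
    unfolding hcomp_def by (intro sum.cong) (auto simp: cprr_def)
  then show ?thesis by auto
qed

lemma hcomp_cinr_right_apply:
  "hcomp N M G (cinr E L M) s r = (if length L \<le> r \<and> r < length L + length M
     then mmul N (G s (r - length L)) (E ! (M ! (r - length L))) else 0)"
proof -
  have "hcomp N M G (cinr E L M) s r = (\<Sum>t<length M. if t = r - length L then
      (if length L \<le> r then mmul N (G s (r - length L)) (E ! (M ! (r - length L))) else 0) else 0)"
    unfolding hcomp_def by (intro sum.cong) (auto simp: cinr_def)
  then show ?thesis by auto
qed

lemma hcomp_cprr_left_apply:
  "hcomp N M (cprr E L M) G s r = (if length L \<le> s \<and> s < length L + length M
     then mmul N (E ! (M ! (s - length L))) (G (s - length L) r) else 0)"
proof -
  have "hcomp N M (cprr E L M) G s r = (\<Sum>t<length M. if t = s - length L then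
      (if length L \<le> s then mmul N (E ! (M ! (s - length L))) (G (s - length L) r) else 0) else 0)"
    unfolding hcomp_def by (intro sum.cong) (auto simp: cprr_def)
  then show ?thesis by auto
qed

lemma hcomp_cinr_cprr:
  assumes "valid M"
  shows "hcomp N (L @ M) (cinr E L M) (cprr E L M) = hid E M"
  by (rule ext, rule ext) (use assms in \<open>auto simp: hcomp_cinr_left_apply cprr_def hid_def E_idem valid_nth\<close>)

lemma hcomp_hid_hid:
  assumes "valid L" "length L \<le> length K"
  shows "hcomp N K (hid E L) (hid E L) = hid E L"
  by (rule ext, rule ext, unfold hcomp_hid_left_apply[OF assms(2)])
    (use assms in \<open>auto simp: hid_def E_idem valid_nth\<close>)

lemma hid_append:
  assumes "valid L" "valid M"
  shows "hcomp N L (hid E L) (hid E L) + hcomp N M (cprr E L M) (cinr E L M) = hid E (L @ M)"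
proof (intro ext)
  fix s r i j
  have "hcomp N L (hid E L) (hid E L) = hid E L"
    by (simp add: assms hcomp_hid_hid)
  then show "(hcomp N L (hid E L) (hid E L) + hcomp N M (cprr E L M) (cinr E L M)) s r i j = hid E (L @ M) s r i j"
    using assms
    by (auto simp: hcomp_cprr_left_apply hid_def cinr_def nth_append E_idem valid_nth)
qed

lemma is_cplx_dsum:
  assumes "is_cplx N A E Y" "is_cplx N A E Z"
  shows "is_cplx N A E (dsum Y Z)"
proof -
  obtain L1 L0 f where Y: "Y = (L1, L0, f)" by (cases Y)
  obtain M1 M0 g where Z: "Z = (M1, M0, g)" by (cases Z)
  have f: "f \<in> homs N A E L1 L0" and g: "g \<in> homs N A E M1 M0"
    using assms by (auto simp: Y Z is_cplx_alt)
  show ?thesis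
    using assms unfolding Y Z
    by (auto simp: dsum_def is_cplx_alt nth_append zero_A zero_fun_def[symmetric]
        homsD(1,2)[OF f] homsD(1,2)[OF g] intro!: homsI homsD(3)[OF g] split: if_splits)
qed

lemma dsum_retractions:
  assumes Y: "is_cplx N A E Y" and Z: "is_cplx N A E Z"
  obtains i p i' p' where "retraction Y (dsum Y Z) i p" "retraction Z (dsum Y Z) i' p'"
    "ccomp N Y p i + ccomp N Z p' i' = cid E (dsum Y Z)"
proof -
  obtain L1 L0 f where Y': "Y = (L1, L0, f)" by (cases Y)
  obtain M1 M0 g where Z': "Z = (M1, M0, g)" by (cases Z)
  obtain F where W': "dsum Y Z = (L1 @ M1, L0 @ M0, F)"
    by (simp add: Y' Z' dsum_def)
  have F: "F s r = (if s < length L1 \<and> r < length L0 then f s r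
        else if length L1 \<le> s \<and> length L0 \<le> r then g (s - length L1) (r - length L0) else 0)" for s r
    using W' by (auto simp: Y' Z' dsum_def zero_fun_def)
  have W: "is_cplx N A E (dsum Y Z)" using Y Z by (rule is_cplx_dsum)
  have vf: "valid L1" "valid L0" and f: "f \<in> homs N A E L1 L0"
    using Y by (auto simp: Y' is_cplx_alt)
  have vg: "valid M1" "valid M0" and g: "g \<in> homs N A E M1 M0"
    using Z by (auto simp: Z' is_cplx_alt)
  define i where "i = (hid E L1, hid E L0)"
  define i' where "i' = (cinr E L1 M1, cinr E L0 M0)"
  define p' where "p' = (cprr E L1 M1, cprr E L0 M0)"
  have "f = hcomp N (L1 @ M1) (hid E L1) F"
  proof (rule ext, rule ext)
    fix s r
    have "f s r = 0" if "\<not> (s < length L1 \<and> r < length L0)"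
      using homsD(3)[OF f that] .
    then show "f s r = hcomp N (L1 @ M1) (hid E L1) F s r"
      using homs_left[OF f vf(1), of s r]
      by (cases "s < length L1"; cases "r < length L0") (simp_all add: hcomp_hid_left_apply F)
  qed
  then have "hcomp N L0 f (hid E L0) = hcomp N (L1 @ M1) (hid E L1) F"
    using hcomp_hid_right[OF f vf(2)] by simp
  then have ci: "chain_map N A E Y (dsum Y Z) i"
    unfolding W' unfolding Y' by (simp add: i_def chain_map_def vf hid_homs)
  have "hcomp N (L0 @ M0) F (hid E L0) = hcomp N L1 (hid E L1) f"
    by (rule ext, rule ext) (use vf f in \<open>auto simp: hcomp_hid_left_apply hcomp_hid_right_apply homs_left homs_right F homsD(3) zero_fun_def[symmetric]\<close>)
  then have cp: "chain_map N A E (dsum Y Z) Y i"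
    unfolding W' unfolding Y' by (simp add: i_def chain_map_def vf hid_homs)
  have "hcomp N M0 g (cinr E L0 M0) = hcomp N (L1 @ M1) (cinr E L1 M1) F"
    by (rule ext, rule ext) (use vg g in \<open>auto simp: hcomp_cinr_left_apply hcomp_cinr_right_apply homs_left homs_right F homsD(3) zero_fun_def[symmetric]\<close>)
  then have ci': "chain_map N A E Z (dsum Y Z) i'"
    unfolding W' unfolding Z' by (simp add: i'_def chain_map_def vg cinr_homs)
  have "hcomp N (L0 @ M0) F (cprr E L0 M0) = hcomp N M1 (cprr E L1 M1) g"
    by (rule ext, rule ext) (use vg g in \<open>auto simp: hcomp_cprr_left_apply hcomp_cprr_right_apply homs_left homs_right F homsD(3) zero_fun_def[symmetric]\<close>)
  then have cp': "chain_map N A E (dsum Y Z) Z p'"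
    unfolding W' unfolding Z' by (simp add: p'_def chain_map_def vg cprr_homs)
  have "retraction Y (dsum Y Z) i i"
    unfolding retraction_def using Y W ci cp unfolding W' unfolding Y'
    by (simp add: ccomp_def i_def hcomp_hid_hid vf cid_def)
  moreover have "retraction Z (dsum Y Z) i' p'"
    unfolding retraction_def using Z W ci' cp' unfolding W' unfolding Z'
    by (simp add: ccomp_def i'_def p'_def hcomp_cinr_cprr vg cid_def)
  moreover have "ccomp N Y i i + ccomp N Z p' i' = cid E (dsum Y Z)"
    unfolding W' unfolding Y' Z' by (simp add: ccomp_def i_def i'_def p'_def cid_def plus_prod_def hid_append vf vg)
  ultimately show thesis by (rule that)
qed

text \<open>By \<open>triv\<close> null endomorphisms of the complex are 0, so its endomorphism ring
  in the homotopy category is the ring of chain maps. A direct sum decomposition yields two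
  complementary idempotents there; one of them is 0, and \<open>contractible_summand\<close> makes
  the corresponding summand vanish.\<close>

lemma indec_cplxI:
  assumes X: "is_cplx N A E (L1, L0, f)"
    and triv: "\<And>h. h \<in> homs N A E L0 L1 \<Longrightarrow> h = 0"
    and nz: "cid E (L1, L0, f) \<noteq> 0"
    and idem: "\<And>a. chain_map N A E (L1, L0, f) (L1, L0, f) a \<Longrightarrow> ccomp N (L1, L0, f) a a = a \<Longrightarrow>
      a = 0 \<or> a = cid E (L1, L0, f)"
  shows "indec_cplx N A E (L1, L0, f)"
proof -
  let ?X = "(L1, L0, f)"
  have null0: "a = 0" if "null N A E ?X ?X a" for a
    using that by (auto simp: null_alt zero_prod_def dest!: triv)
  have "contractible N A E Y \<or> contractible N A E Z"
    if Y: "is_cplx N A E Y" and Z: "is_cplx N A E Z" and iso: "kiso N A E ?X (dsum Y Z)" for Y Z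
  proof -
    define W where "W = dsum Y Z"
    obtain i p i' p' where r: "retraction Y W i p" and r': "retraction Z W i' p'"
      and s: "ccomp N Y p i + ccomp N Z p' i' = cid E W"
      using dsum_retractions[OF Y Z] unfolding W_def by blast
    obtain a b where a: "chain_map N A E ?X W a" and b: "chain_map N A E W ?X b"
      and ab: "null N A E ?X ?X (ccomp N W a b - cid E ?X)"
      and ba: "null N A E W W (ccomp N ?X b a - cid E W)"
      using iso unfolding kiso_def W_def homotopic_iff_null by blast
    have W: "is_cplx N A E W" and i: "chain_map N A E Y W i" and p: "chain_map N A E W Y p"
      and ip: "ccomp N W i p = cid E Y"
      using r by (auto simp: retraction_def)
    define q where "q = ccomp N Y p i"
    have q: "chain_map N A E W W q"
      unfolding q_def using Y W i p by (meson chain_map_ccomp)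
    have qq: "ccomp N W q q = q"
    proof -
      have "ccomp N W q q = ccomp N Y p (ccomp N Y (ccomp N W i p) i)"
        by (simp add: q_def ccomp_assoc)
      then show ?thesis
        using ip ccomp_cid_left[OF Y i] by (simp add: q_def)
    qed
    define e where "e = ccomp N W a (ccomp N W q b)"
    have e: "chain_map N A E ?X ?X e"
      unfolding e_def using X W a b q by (meson chain_map_ccomp)
    \<comment> \<open>The homotopy on \<open>W\<close> is sandwiched between a map from
      \<open>?X\<close> and a map to \<open>?X\<close>, where null maps are 0. This makes
      \<open>e\<close> strictly idempotent although \<open>W\<close> itself may carry nonzero
      homotopies.\<close>
    have "null N A E ?X ?X (ccomp N W a (ccomp N W q (ccomp N W (ccomp N ?X b a - cid E W) (ccomp N W q b))))"
      using X W a b q ba by (meson chain_map_ccomp null_ccomp_left null_ccomp_right)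
    then have "ccomp N W a (ccomp N W q (ccomp N W (ccomp N ?X b a - cid E W) (ccomp N W q b))) = 0"
      by (rule null0)
    moreover have "ccomp N W (cid E W) (ccomp N W q b) = ccomp N W q b"
      using ccomp_cid_left[OF W chain_map_ccomp[OF W W X q b]] .
    moreover have "ccomp N W q (ccomp N W q b) = ccomp N W q b"
      by (simp add: qq flip: ccomp_assoc)
    ultimately have "ccomp N ?X e e = e"
      by (simp add: e_def ccomp_diff_left ccomp_diff_right ccomp_assoc)
    then consider "e = 0" | "e = cid E ?X"
      using idem[OF e] by blast
    then show ?thesis
    proof cases
      case 1
      then have "contractible N A E Y"
        by (intro contractible_summand[OF r X a b ba]) (simp add: e_def q_def ccomp_assoc)
      then show ?thesis ..
    next
      case 2
      have "ccomp N W a b = cid E ?X"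
        using null0[OF ab] by simp
      moreover have "ccomp N W a (ccomp N W (cid E W) b) = ccomp N W a b"
        using ccomp_cid_left[OF W b] by simp
      ultimately have "e + ccomp N W a (ccomp N W (ccomp N Z p' i') b) = cid E ?X"
        by (simp add: e_def q_def flip: s ccomp_add_left ccomp_add_right)
      then have "ccomp N W a (ccomp N W (ccomp N Z p' i') b) = 0"
        using 2 by simp
      then have "contractible N A E Z"
        by (intro contractible_summand[OF r' X a b ba]) (simp add: ccomp_assoc)
      then show ?thesis ..
    qed
  qed
  moreover have "\<not> contractible N A E ?X"
    using nz null0[of "cid E ?X"] unfolding contractible_def by blast
  ultimately show ?thesis
    using X by (simp add: indec_cplx_def kiso_zero_cplx)
qed

lemma contractible_dsum:
  assumes "is_cplx N A E Y" "is_cplx N A E Z" "contractible N A E (dsum Y Z)"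
  shows "contractible N A E Y" "contractible N A E Z"
  using dsum_retractions[OF assms(1,2)] contractible_retract assms(3) by metis+

lemma is_cplx_dsums: "(\<And>X. X \<in> set Xs \<Longrightarrow> is_cplx N A E X) \<Longrightarrow> is_cplx N A E (dsums Xs)"
  by (induction Xs) (auto simp: dsums_def is_cplx_zero_cplx is_cplx_dsum)

text \<open>Splitting off the head forces the rest to be contractible, which any further member
  would contradict. This is the only part of Krull-Schmidt uniqueness that the proof calls
  for.\<close>

lemma indec_dsums:
  assumes X: "indec_cplx N A E X" and iso: "kiso N A E X (dsums Ys)"
    and Ys: "\<And>Y. Y \<in> set Ys \<Longrightarrow> is_cplx N A E Y \<and> \<not> contractible N A E Y"
  shows "length Ys = 1"
proof (cases Ys)
  case Nil
  then show ?thesis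
    using X iso by (simp add: dsums_def indec_cplx_def)
next
  case (Cons Y Zs)
  have Zs: "is_cplx N A E (dsums Zs)"
    using Ys Cons by (intro is_cplx_dsums) auto
  have "kiso N A E X (dsum Y (dsums Zs))"
    using iso by (simp add: dsums_def Cons)
  then have "contractible N A E Y \<or> contractible N A E (dsums Zs)"
    using X Ys[of Y] Zs unfolding Cons indec_cplx_def kiso_zero_cplx by (meson list.set_intros(1))
  then have c: "contractible N A E (dsums Zs)"
    using Ys Cons by auto
  show ?thesis
  proof (cases Zs)
    case (Cons Z Zs')
    have "contractible N A E Z"
      using c Ys \<open>Ys = Y # Zs\<close> Cons
      by (intro contractible_dsum(1)[of Z "dsums Zs'"] is_cplx_dsums) (auto simp: dsums_def)
    then show ?thesis
      using Ys \<open>Ys = Y # Zs\<close> Cons by auto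
  qed (use \<open>Ys = Y # Zs\<close> in simp)
qed

end

section \<open>Canonical decompositions of an indecomposable class\<close>

lemma general_conj:
  assumes "general V P" "general V Q"
  obtains f where "f \<in> V" "P f" "Q f"
  using assms unfolding general_def zariski_dense_def
  by (metis (no_types, lifting) Int_emptyI mem_Collect_eq zariski_open_def)

lemma set_pos_list: "set (pos_list n \<theta>) = {i. i < n \<and> \<theta> i > 0}"
  by (auto simp: pos_list_def)

lemma set_neg_list: "set (neg_list n \<theta>) = {i. i < n \<and> \<theta> i < 0}"
  by (auto simp: neg_list_def)

text \<open>Round trips between distinct projectives vanish, as for a quiver without oriented
  cycles. Hence no identity of a projective factors through a sum of other ones.\<close>

locale directed_projectives = projectives +
  assumes nonzero: "i < length E \<Longrightarrow> E ! i \<noteq> 0"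
    and directed: "\<And>i j X Y. i < length E \<Longrightarrow> j < length E \<Longrightarrow> i \<noteq> j \<Longrightarrow> X \<in> A \<Longrightarrow> Y \<in> A \<Longrightarrow>
      mmul N (E ! i) (mmul N X (mmul N (E ! j) (mmul N Y (E ! i)))) = 0"
begin

text \<open>The first diagonal entry of the composite is a sum of round trips, hence 0, while that
  of the identity is a nonzero idempotent.\<close>

lemma hcomp_loop:
  assumes f: "f \<in> homs N A E L M" and g: "g \<in> homs N A E M L" and "valid L" "valid M"
    and disj: "set L \<inter> set M = {}" and id: "hcomp N M f g = hid E L"
  shows "L = []"
proof (rule ccontr)
  assume "L \<noteq> []"
  then have L: "0 < length L" by simp
  have "mmul N (f 0 r) (g r 0) = 0" if r: "r < length M" for r
  proof -
    have "L ! 0 \<noteq> M ! r"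
      using disj nth_mem[OF L] nth_mem[OF r] by auto
    moreover have "mmul N (f 0 r) (g r 0) = mmul N (mmul N (mmul N (E ! (L ! 0)) (f 0 r)) (E ! (M ! r))) (mmul N (g r 0) (E ! (L ! 0)))"
      using homs_left[OF f] homs_right[OF f] homs_right[OF g] assms L r by simp
    ultimately show ?thesis
      using directed[of "L ! 0" "M ! r" "f 0 r" "g r 0"] assms L r
      by (simp add: mmul_assoc valid_nth homsD(1)[OF f] homsD(1)[OF g])
  qed
  then have "hcomp N M f g 0 0 = 0"
    by (simp add: hcomp_def)
  then show False
    using id L nonzero[OF valid_nth[OF \<open>valid L\<close> L]] by (simp add: hid_def)
qed

lemma is_cplx_Pf: "f \<in> Hom\<theta> N A E t \<Longrightarrow> is_cplx N A E (Pf E t f)"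
  by (auto simp: Pf_def Hom\<theta>_def is_cplx_def set_pos_list set_neg_list)

text \<open>A contraction is a two-sided inverse of \<open>f\<close>, so the two terms would be
  isomorphic; but they share no index.\<close>

lemma contractible_Pf:
  assumes f: "f \<in> Hom\<theta> N A E t" and c: "contractible N A E (Pf E t f)"
  shows "neg_list (length E) t = []" "pos_list (length E) t = []"
proof -
  let ?L = "neg_list (length E) t" and ?M = "pos_list (length E) t"
  have v: "valid ?L" "valid ?M"
    by (auto simp: valid_def set_pos_list set_neg_list)
  have disj: "set ?L \<inter> set ?M = {}" "set ?M \<inter> set ?L = {}"
    by (auto simp: set_pos_list set_neg_list)
  obtain h where h: "h \<in> homs N A E ?M ?L" "hcomp N ?M f h = hid E ?L" "hcomp N ?L h f = hid E ?M"
    using c by (auto simp: contractible_def Pf_def null_alt cid_def)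
  show "?L = []" "?M = []"
    using hcomp_loop[OF _ h(1) v disj(1) h(2)] hcomp_loop[OF h(1) _ v(2) v(1) disj(2) h(3)] f
    by (auto simp: Hom\<theta>_def)
qed

text \<open>The maps \<open>fs\<close> in \<open>canon_decomp\<close> are arbitrary, not general, so
  every \<open>f\<close> has to be covered. One contractible member already empties both lists, and
  then the general members would be contractible too.\<close>

lemma indec_elt_not_contractible:
  assumes t: "indec_elt N A E t" and f: "f \<in> Hom\<theta> N A E t"
  shows "\<not> contractible N A E (Pf E t f)"
proof
  assume "contractible N A E (Pf E t f)"
  then have e: "neg_list (length E) t = []" "pos_list (length E) t = []"
    using contractible_Pf[OF f] by auto
  obtain g where g: "g \<in> Hom\<theta> N A E t" "indec_cplx N A E (Pf E t g)"
    using t unfolding indec_elt_def by (metis general_conj)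
  have "cid E (Pf E t g) = 0"
    by (auto simp: Pf_def e cid_def hid_def zero_prod_def fun_eq_iff)
  then have "contractible N A E (Pf E t g)"
    by (simp add: contractible_def null_zero)
  then show False
    using g by (simp add: indec_cplx_def kiso_zero_cplx)
qed

text \<open>Some \<open>f\<close> is general for both properties at once, and
  \<open>indec_dsums\<close> applies to it. The result serves twice: it determines
  \<open>ind\<close> of the class, and it refutes indecomposability of its double.\<close>

lemma canon_decomp_indec_elt:
  assumes "indec_elt N A E \<theta>" "canon_decomp N A E \<theta> ts"
  shows "ts = [\<theta>]"
proof -
  have ts: "\<theta> = sum_list ts" "\<And>t. t \<in> set ts \<Longrightarrow> indec_elt N A E t"
    using assms(2) by (auto simp: canon_decomp_def)
  have g: "general (Hom\<theta> N A E \<theta>) (\<lambda>f. indec_cplx N A E (Pf E \<theta> f))"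
    "general (Hom\<theta> N A E \<theta>) (\<lambda>f. \<exists>fs. length fs = length ts \<and>
        (\<forall>i<length ts. fs!i \<in> Hom\<theta> N A E (ts!i)) \<and>
        kiso N A E (Pf E \<theta> f) (dsums (map (\<lambda>i. Pf E (ts!i) (fs!i)) [0..<length ts])))"
    using assms by (auto simp: indec_elt_def canon_decomp_def)
  obtain f fs where f: "indec_cplx N A E (Pf E \<theta> f)"
    and fs: "length fs = length ts" "\<And>i. i < length ts \<Longrightarrow> fs ! i \<in> Hom\<theta> N A E (ts ! i)"
      "kiso N A E (Pf E \<theta> f) (dsums (map (\<lambda>i. Pf E (ts!i) (fs!i)) [0..<length ts]))"
    using general_conj[OF g] by blast
  have "length (map (\<lambda>i. Pf E (ts!i) (fs!i)) [0..<length ts]) = 1"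
  proof (rule indec_dsums[OF f fs(3)])
    fix Y assume "Y \<in> set (map (\<lambda>i. Pf E (ts!i) (fs!i)) [0..<length ts])"
    then obtain i where i: "i < length ts" "Y = Pf E (ts!i) (fs!i)" by auto
    then show "is_cplx N A E Y \<and> \<not> contractible N A E Y"
      using fs(2) ts(2) by (auto simp: is_cplx_Pf indec_elt_not_contractible)
  qed
  then obtain t where "ts = [t]"
    by (auto simp: length_Suc_conv)
  then show ?thesis
    using ts(1) by simp
qed

end

section \<open>General elements\<close>

text \<open>Over a finite field, 1 plus the product of all monic linear factors has positive degree
  and no root.\<close>

lemma infinite_UNIV_alg_closed: "infinite (UNIV :: 'k::alg_closed_field set)"
proof
  assume fin: "finite (UNIV :: 'k set)"
  define p :: "'k poly" where "p = (\<Prod>a\<in>UNIV. [:-a, 1:]) + 1"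
  have d: "degree (\<Prod>a\<in>(UNIV::'k set). [:-a, 1:]) = card (UNIV :: 'k set)"
    by (subst degree_prod_eq_sum_degree) auto
  have "card (UNIV :: 'k set) > 0"
    using fin by (simp add: card_gt_0_iff)
  then have "degree p > 0"
    unfolding p_def using d by (subst degree_add_eq_left) auto
  then obtain x where "poly p x = 0"
    using alg_closed_imp_poly_has_root by blast
  moreover have "poly (\<Prod>a\<in>(UNIV::'k set). [:-a, 1:]) x = 0"
    using fin by (auto simp: poly_prod prod_zero_iff intro!: bexI[of _ x])
  ultimately show False
    by (simp add: p_def)
qed

definition line :: "'k::field hm \<Rightarrow> 'k hm \<Rightarrow> 'k \<Rightarrow> 'k hm" where
  "line \<phi> \<psi> t = (\<lambda>s r i j. \<phi> s r i j + t * (\<psi> s r i j - \<phi> s r i j))"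

lemma polyfun_line:
  assumes "p \<in> polyfun"
  shows "\<exists>P. \<forall>t. p (line \<phi> \<psi> t) = poly P t"
  using assms
proof induction
  case (pf_const c)
  show ?case by (rule exI[of _ "[:c:]"]) simp
next
  case (pf_coord s r i j)
  show ?case
    by (rule exI[of _ "[:\<phi> s r i j, \<psi> s r i j - \<phi> s r i j:]"]) (simp add: line_def)
next
  case (pf_add p q)
  then show ?case by (metis poly_add)
next
  case (pf_mult p q)
  then show ?case by (metis poly_mult)
qed

text \<open>Nonempty open subsets of an affine space over an infinite field meet: restrict the two
nonvanishing polynomials to a line.\<close>

lemma generalI:
  fixes V :: "'k::alg_closed_field hm set"
  assumes V: "\<And>\<phi> \<psi> t. \<phi> \<in> V \<Longrightarrow> \<psi> \<in> V \<Longrightarrow> line \<phi> \<psi> t \<in> V"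
    and p: "p \<in> polyfun" and \<phi>: "\<phi> \<in> V" "p \<phi> \<noteq> 0"
    and P: "\<And>f. f \<in> V \<Longrightarrow> p f \<noteq> 0 \<Longrightarrow> P f"
  shows "general V P"
proof -
  let ?U = "{f\<in>V. p f \<noteq> 0}"
  have "zariski_open V ?U"
    unfolding zariski_open_def by (rule exI[of _ "{p}"]) (use p in auto)
  moreover have "zariski_dense V ?U"
    unfolding zariski_dense_def
  proof (intro allI impI)
    fix W assume "zariski_open V W \<and> W \<noteq> {}"
    then obtain q \<psi> where q: "q \<in> polyfun" "\<psi> \<in> V" "q \<psi> \<noteq> 0" "\<And>f. f \<in> V \<Longrightarrow> q f \<noteq> 0 \<Longrightarrow> f \<in> W"
      unfolding zariski_open_def by blast
    obtain R where R: "\<And>t. p (line \<phi> \<psi> t) = poly R t"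
      using polyfun_line[OF p] by blast
    obtain S where S: "\<And>t. q (line \<phi> \<psi> t) = poly S t"
      using polyfun_line[OF q(1)] by blast
    have "line \<phi> \<psi> 0 = \<phi>" "line \<phi> \<psi> 1 = \<psi>"
      by (auto simp: line_def fun_eq_iff)
    then have "poly R 0 \<noteq> 0" "poly S 1 \<noteq> 0"
      using \<phi>(2) q(3) by (simp_all flip: R S)
    then have "R * S \<noteq> 0" by auto
    then have "finite {t. poly (R * S) t = 0}"
      by (rule poly_roots_finite)
    then obtain t where "poly (R * S) t \<noteq> 0"
      using infinite_UNIV_alg_closed[where 'k = 'k]
      by (metis (mono_tags, lifting) UNIV_eq_I mem_Collect_eq)
    then have "line \<phi> \<psi> t \<in> W \<inter> ?U"
      using V[OF \<phi>(1) q(2)] q(4) by (auto simp flip: R S)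
    then show "W \<inter> ?U \<noteq> {}" by blast
  qed
  ultimately show ?thesis
    unfolding general_def using \<phi> P by (intro exI[of _ ?U]) auto
qed

lemma mmul_msc_left: "mmul N (msc c X) Y = msc c (mmul N X Y)"
  and mmul_msc_right: "mmul N X (msc c Y) = msc c (mmul N X Y)"
  by (auto simp: mmul_def msc_def sum_distrib_left mult_ac fun_eq_iff)

lemma (in projectives) homs_line:
  assumes \<phi>: "\<phi> \<in> homs N A E L M" and \<psi>: "\<psi> \<in> homs N A E L M"
  shows "line \<phi> \<psi> t \<in> homs N A E L M"
proof -
  have "(\<lambda>s r. msc t (\<theta> s r)) \<in> homs N A E L M" if \<theta>: "\<theta> \<in> homs N A E L M" for \<theta>
  proof (rule homsI)
    show "msc t (\<theta> s r) \<in> A" if "s < length L" "r < length M" for s r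
      using alg homsD(1)[OF \<theta> that] by (auto simp: fd_alg_def)
    show "mmul N (mmul N (E ! (L ! s)) (msc t (\<theta> s r))) (E ! (M ! r)) = msc t (\<theta> s r)"
      if "s < length L" "r < length M" for s r
      using homsD(2)[OF \<theta> that] by (simp add: mmul_msc_left mmul_msc_right)
    show "msc t (\<theta> s r) = 0" if "\<not> (s < length L \<and> r < length M)" for s r
      using homsD(3)[OF \<theta> that] by (simp add: msc_def fun_eq_iff)
  qed
  from homs_add[OF \<phi> this[OF homs_diff[OF \<psi> \<phi>]]] show ?thesis
    by (simp add: line_def msc_def plus_fun_def fun_diff_def)
qed

section \<open>The algebra\<close>

definition cross :: "(nat \<Rightarrow> 'k::field) \<Rightarrow> (nat \<Rightarrow> 'k) \<Rightarrow> nat \<Rightarrow> 'k" where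
  "cross v w = (\<lambda>i. if i = 0 then v 1 * w 2 - v 2 * w 1
     else if i = 1 then v 2 * w 0 - v 0 * w 2 else v 0 * w 1 - v 1 * w 0)"

text \<open>The matrix of \<open>cross v\<close> acting on columns.\<close>

definition skew :: "(nat \<Rightarrow> 'k::field) \<Rightarrow> 'k sq" where
  "skew v = (\<lambda>i j. if i = 0 \<and> j = 1 then - v 2 else if i = 0 \<and> j = 2 then v 1
     else if i = 1 \<and> j = 0 then v 2 else if i = 1 \<and> j = 2 then - v 0
     else if i = 2 \<and> j = 0 then - v 1 else if i = 2 \<and> j = 1 then v 0 else 0)"

text \<open>The path algebra of the quiver with three arrows from 0 to 1 and three from 1 to 2, modulo the
relations turning the composition of arrows into the cross product, in its action on the
projective of the last vertex: \<open>a\<close>, \<open>b\<close>, \<open>c\<close> are the coefficients of the three idempotents, \<open>v\<close>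
and \<open>w\<close> those of the two sets of arrows and \<open>u\<close> those of the paths of length two.\<close>

definition mk :: "'k::field \<Rightarrow> 'k \<Rightarrow> 'k \<Rightarrow> (nat \<Rightarrow> 'k) \<Rightarrow> (nat \<Rightarrow> 'k) \<Rightarrow> (nat \<Rightarrow> 'k) \<Rightarrow> 'k sq" where
  "mk a b c v w u = (\<lambda>i j.
     if i < 3 then (if j < 3 then (if i = j then a else 0) else if j < 6 then skew v i (j - 3)
       else if j = 6 then u i else 0)
     else if i < 6 then (if i = j then b else if j = 6 then w (i - 3) else 0)
     else if i = 6 \<and> j = 6 then c else 0)"

definition alg7 :: "'k::field sq set" where
  "alg7 = {mk a b c v w u | a b c v w u. True}"

text \<open>Each coefficient occurs twice in the skew block, with opposite signs; it is read where
  the sign is positive. The columns of that block start at 3.\<close>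

definition vco :: "'k::field sq \<Rightarrow> nat \<Rightarrow> 'k" where
  "vco X i = (if i = 0 then X 2 4 else if i = 1 then X 0 5 else X 1 3)"

definition wco :: "'k::field sq \<Rightarrow> nat \<Rightarrow> 'k" where
  "wco X i = X (3 + i) 6"

definition uco :: "'k::field sq \<Rightarrow> nat \<Rightarrow> 'k" where
  "uco X i = X i 6"

definition reps :: "'k::field sq list" where
  "reps = [mk 1 0 0 0 0 0, mk 0 1 0 0 0 0, mk 0 0 1 0 0 0]"

lemma all_less_7: "(\<forall>i<(7::nat). P i) \<longleftrightarrow> P 0 \<and> P (Suc 0) \<and> P 2 \<and> P 3 \<and> P 4 \<and> P 5 \<and> P 6"
proof -
  have "i < 7 \<longleftrightarrow> i = 0 \<or> i = Suc 0 \<or> i = 2 \<or> i = 3 \<or> i = 4 \<or> i = 5 \<or> i = 6" for i :: nat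
    by linarith
  then show ?thesis by auto
qed

lemma supp_sq_eqI:
  assumes "X \<in> supp_sq N" "Y \<in> supp_sq N" "\<forall>i<N. \<forall>j<N. X i j = Y i j"
  shows "X = Y"
proof (intro ext)
  fix i j show "X i j = Y i j"
    using assms by (cases "i < N \<and> j < N") (auto simp: supp_sq_def)
qed

lemma mmul_supp: "X \<in> supp_sq N \<Longrightarrow> Y \<in> supp_sq N \<Longrightarrow> mmul N X Y \<in> supp_sq N"
  by (auto simp: supp_sq_def mmul_def)

lemma mk_supp: "mk a b c v w u \<in> supp_sq 7"
  by (auto simp: supp_sq_def mk_def)

lemma mk_mult: "mmul 7 (mk a b c v w u) (mk a' b' c' v' w' u') =
   mk (a * a') (b * b') (c * c') (\<lambda>i. a * v' i + v i * b') (\<lambda>i. b * w' i + w i * c')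
     (\<lambda>i. a * u' i + cross v w' i + u i * c')"
proof (rule supp_sq_eqI[of _ 7])
  have s: "(\<Sum>l<7. f l) = f 0 + f 1 + f 2 + f 3 + f 4 + f 5 + f 6" for f :: "nat \<Rightarrow> 'a"
    by (simp add: eval_nat_numeral)
  show "\<forall>i<7. \<forall>j<7. mmul 7 (mk a b c v w u) (mk a' b' c' v' w' u') i j =
   mk (a * a') (b * b') (c * c') (\<lambda>i. a * v' i + v i * b') (\<lambda>i. b * w' i + w i * c')
     (\<lambda>i. a * u' i + cross v w' i + u i * c') i j"
    unfolding mmul_def s all_less_7
    by (simp add: mk_def skew_def cross_def)
qed (intro mmul_supp mk_supp)+

text \<open>The coefficient functions are read only at 0, 1 and 2, so equal matrices need not come
  from equal functions.\<close>

lemma mk_eq_iff: "mk a b c v w u = mk a' b' c' v' w' u' \<longleftrightarrow> a = a' \<and> b = b' \<and> c = c' \<and>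
   v 0 = v' 0 \<and> v 1 = v' 1 \<and> v 2 = v' 2 \<and> w 0 = w' 0 \<and> w 1 = w' 1 \<and> w 2 = w' 2 \<and>
   u 0 = u' 0 \<and> u 1 = u' 1 \<and> u 2 = u' 2"
  (is "?X = ?Y \<longleftrightarrow> ?R")
proof
  assume "?X = ?Y"
  then have e: "?X i j = ?Y i j" for i j by simp
  show ?R
    using e[of 0 0] e[of 3 3] e[of 6 6] e[of 2 4] e[of 0 5] e[of 1 3] e[of 3 6] e[of 4 6] e[of 5 6]
      e[of 0 6] e[of 1 6] e[of 2 6]
    by (simp add: mk_def skew_def)
next
  assume r: ?R
  show "?X = ?Y"
  proof (rule supp_sq_eqI[OF mk_supp mk_supp])
    show "\<forall>i<7. \<forall>j<7. ?X i j = ?Y i j"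
      using r unfolding all_less_7 by (simp add: mk_def skew_def)
  qed
qed

lemma mk_add: "mk a b c v w u + mk a' b' c' v' w' u' =
    mk (a + a') (b + b') (c + c') (\<lambda>i. v i + v' i) (\<lambda>i. w i + w' i) (\<lambda>i. u i + u' i)"
  by (auto simp: mk_def skew_def fun_eq_iff)

lemma mk_msc: "msc t (mk a b c v w u) =
    mk (t * a) (t * b) (t * c) (\<lambda>i. t * v i) (\<lambda>i. t * w i) (\<lambda>i. t * u i)"
  by (auto simp: mk_def skew_def fun_eq_iff msc_def)

lemma mk_0: "mk 0 0 0 0 0 0 = 0"
  by (auto simp: mk_def skew_def fun_eq_iff)

lemma mk_eq_0_iff: "mk a b c v w u = 0 \<longleftrightarrow> a = 0 \<and> b = 0 \<and> c = 0 \<and>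
   v 0 = 0 \<and> v 1 = 0 \<and> v 2 = 0 \<and> w 0 = 0 \<and> w 1 = 0 \<and> w 2 = 0 \<and> u 0 = 0 \<and> u 1 = 0 \<and> u 2 = 0"
  unfolding mk_0[symmetric] mk_eq_iff by simp

lemma mk_munit: "munit 7 = mk 1 1 1 0 0 0"
  by (auto simp: mk_def skew_def fun_eq_iff munit_def)

lemma mk_alg7: "mk a b c v w u \<in> alg7"
  unfolding alg7_def by blast

lemma alg7E:
  assumes "X \<in> alg7"
  obtains a b c v w u where "X = mk a b c v w u"
  using assms unfolding alg7_def by blast

lemma alg7_coords:
  assumes "X \<in> alg7"
  shows "X = mk (X 0 0) (X 3 3) (X 6 6) (vco X) (wco X) (uco X)"
proof -
  obtain a b c v w u where X: "X = mk a b c v w u"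
    using assms by (auto simp: alg7_def)
  show ?thesis
    unfolding X mk_eq_iff by (simp add: mk_def skew_def vco_def wco_def uco_def)
qed

lemma vco_mk: "vco (mk a b c v w u) 0 = v 0" "vco (mk a b c v w u) (Suc 0) = v 1" "vco (mk a b c v w u) 2 = v 2"
  by (simp_all add: vco_def mk_def skew_def)

lemma fd_alg7: "fd_alg 7 alg7"
  unfolding fd_alg_def
proof (intro conjI ballI allI)
  show "(alg7 :: 'a sq set) \<subseteq> supp_sq 7"
    using mk_supp by (auto simp: alg7_def)
  show "(0 :: 'a sq) \<in> alg7" "munit 7 \<in> (alg7 :: 'a sq set)"
    unfolding mk_munit mk_0[symmetric] by (rule mk_alg7)+
  fix X Y :: "'a sq" and c :: 'a assume "X \<in> alg7" "Y \<in> alg7"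
  then show "X + Y \<in> alg7" "mmul 7 X Y \<in> alg7" "msc c X \<in> alg7"
    by (auto elim!: alg7E simp: mk_add mk_mult mk_msc mk_alg7)
qed

section \<open>Idempotents and indecomposable projectives of the algebra\<close>

lemma length_reps: "length reps = 3"
  by (simp add: reps_def)

lemma reps_nth: "reps ! 0 = mk 1 0 0 0 0 0" "reps ! Suc 0 = mk 0 1 0 0 0 0" "reps ! 2 = mk 0 0 1 0 0 0"
  by (simp_all add: reps_def)

lemma less_3_cases: "(i::nat) < 3 \<Longrightarrow> i = 0 \<or> i = Suc 0 \<or> i = 2"
  by linarith

lemma idem_reps: "i < length (reps :: 'k::field sq list) \<Longrightarrow> idem 7 alg7 (reps ! i :: 'k sq)"
  by (auto dest!: less_3_cases simp: length_reps reps_nth idem_def mk_alg7 mk_mult mk_eq_iff cross_def)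

text \<open>The Peirce decomposition: diagonal corners are one-dimensional, those above the diagonal
  are V, U and W, those below it vanish. The shape of all morphisms between projectives is read off
  from it.\<close>

lemma corner:
  fixes X :: "'k::field sq"
  assumes "X \<in> alg7"
  shows "mmul 7 (mmul 7 (reps ! 0) X) (reps ! 0) = mk (X 0 0) 0 0 0 0 0"
    "mmul 7 (mmul 7 (reps ! 0) X) (reps ! Suc 0) = mk 0 0 0 (vco X) 0 0"
    "mmul 7 (mmul 7 (reps ! 0) X) (reps ! 2) = mk 0 0 0 0 0 (uco X)"
    "mmul 7 (mmul 7 (reps ! Suc 0) X) (reps ! 0) = 0"
    "mmul 7 (mmul 7 (reps ! Suc 0) X) (reps ! Suc 0) = mk 0 (X 3 3) 0 0 0 0"
    "mmul 7 (mmul 7 (reps ! Suc 0) X) (reps ! 2) = mk 0 0 0 0 (wco X) 0"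
    "mmul 7 (mmul 7 (reps ! 2) X) (reps ! 0) = 0"
    "mmul 7 (mmul 7 (reps ! 2) X) (reps ! Suc 0) = 0"
    "mmul 7 (mmul 7 (reps ! 2) X) (reps ! 2) = mk 0 0 (X 6 6) 0 0 0"
  unfolding reps_nth
  by (subst alg7_coords[OF assms], simp add: mk_mult mk_eq_iff mk_eq_0_iff cross_def)+

lemma corner_swap_zero:
  fixes X Y :: "'k::field sq"
  assumes "i < length (reps :: 'k sq list)" "j < length (reps :: 'k sq list)" "i \<noteq> j" "X \<in> alg7" "Y \<in> alg7"
  shows "mmul 7 (reps ! i) (mmul 7 X (mmul 7 (reps ! j) (mmul 7 Y (reps ! i)))) = 0"
  using assms(1-3) unfolding length_reps
  by (subst alg7_coords[OF assms(4)], subst alg7_coords[OF assms(5)])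
    (auto dest!: less_3_cases simp: reps_nth mk_mult mk_eq_0_iff cross_def)

interpretation A7: directed_projectives 7 "alg7 :: 'k::field sq set" reps
proof
  show "fd_alg 7 (alg7 :: 'k sq set)" by (rule fd_alg7)
  fix i j :: nat and X Y :: "'k sq"
  assume i: "i < length (reps :: 'k sq list)"
  show "idem 7 alg7 (reps ! i :: 'k sq)"
    using i by (rule idem_reps)
  show "(reps ! i :: 'k sq) \<noteq> 0"
    using i by (auto dest!: less_3_cases simp: length_reps reps_nth mk_eq_0_iff)
  show "mmul 7 (reps ! i) (mmul 7 X (mmul 7 (reps ! j) (mmul 7 Y (reps ! i)))) = 0"
    if "j < length (reps :: 'k sq list)" "i \<noteq> j" "X \<in> alg7" "Y \<in> alg7"
    using corner_swap_zero i that by blast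
qed

lemma idem_scalar: "(a::'k::field) * a = a \<Longrightarrow> a = 0 \<or> a = 1"
  by (metis mult_cancel_right1)

text \<open>A summand of the idempotent lies in its corner, which consists of its scalar multiples;
  idempotent scalars are 0 and 1.\<close>

lemma primitive_idem_reps:
  assumes i: "i < length (reps :: 'k::field sq list)"
  shows "primitive_idem 7 alg7 (reps ! i :: 'k sq)"
  unfolding primitive_idem_def
proof (intro conjI allI impI)
  show "idem 7 alg7 (reps ! i :: 'k sq)" by (rule idem_reps[OF i])
  show "(reps ! i :: 'k sq) \<noteq> 0" by (rule A7.nonzero[OF i])
  fix e1 e2 :: "'k sq"
  assume e: "idem 7 alg7 e1 \<and> idem 7 alg7 e2 \<and> mmul 7 e1 e2 = 0 \<and> mmul 7 e2 e1 = 0 \<and> reps ! i = e1 + e2"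
  then have e1: "e1 \<in> alg7" "mmul 7 e1 e1 = e1" and e2: "mmul 7 e2 e2 = e2"
    by (auto simp: idem_def)
  have c: "mmul 7 (mmul 7 (reps ! i) e1) (reps ! i) = e1"
    using e e1 by (simp add: mmul_add_left mmul_add_right)
  have "e1 = 0 \<or> e1 = reps ! i"
  proof -
    have m: "msc x (reps ! 0) = mk x 0 0 0 0 0" "msc x (reps ! Suc 0) = mk 0 x 0 0 0 0"
      "msc x (reps ! 2) = mk 0 0 x 0 0 0" for x :: 'k
      by (simp_all add: reps_nth mk_msc mk_eq_iff)
    have "\<exists>x. e1 = msc x (reps ! i)"
      using i less_3_cases[of i] c corner(1,5,9)[OF e1(1)] m unfolding length_reps by metis
    then obtain x where x: "e1 = msc x (reps ! i)" by blast
    have "msc (x * x) (reps ! i) = msc x (reps ! i)"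
      using e1(2) i unfolding x length_reps
      by (auto dest!: less_3_cases simp: reps_nth mk_msc mk_mult mk_eq_iff)
    then have "x * x = x"
      using i unfolding length_reps by (auto dest!: less_3_cases simp: reps_nth mk_msc mk_eq_iff)
    then have "x = 0 \<or> x = 1" by (rule idem_scalar)
    then show ?thesis
      using x by (auto simp: msc_def fun_eq_iff)
  qed
  then show "e1 = 0 \<or> e2 = 0"
    using e e2 by auto
qed

lemma not_proj_iso_reps:
  assumes i: "i < length (reps :: 'k::field sq list)" and j: "j < length (reps :: 'k sq list)" and "i \<noteq> j"
  shows "\<not> proj_iso 7 alg7 (reps ! i :: 'k sq) (reps ! j)"
proof
  assume "proj_iso 7 alg7 (reps ! i :: 'k sq) (reps ! j)"
  then obtain a b :: "'k sq" where ab: "a \<in> alg7" "b \<in> alg7" "a = mmul 7 (mmul 7 (reps ! i) a) (reps ! j)"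
    "b = mmul 7 (mmul 7 (reps ! j) b) (reps ! i)" "mmul 7 a b = reps ! i"
    unfolding proj_iso_def by blast
  have "reps ! i = mmul 7 (mmul 7 (mmul 7 (reps ! i) a) (reps ! j)) (mmul 7 b (reps ! i))"
    using ab(3-5) A7.E_idem[OF i] by (metis mmul_assoc)
  also have "\<dots> = 0"
    using A7.directed[OF i j \<open>i \<noteq> j\<close> ab(1,2)] by (simp add: mmul_assoc)
  finally show False
    using A7.nonzero[OF i] by blast
qed

text \<open>The map \<open>B r \<rightarrow> B e\<close> given by \<open>r e\<close> splits as soon as \<open>r e r = r\<close>.\<close>

lemma proj_iso_primitive:
  assumes e: "primitive_idem 7 alg7 e" and r: "idem 7 alg7 r" "r \<noteq> 0" and ere: "mmul 7 (mmul 7 r e) r = r"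
  shows "proj_iso 7 alg7 e r"
proof -
  have ee: "mmul 7 e e = e" "e \<in> alg7" and rr: "mmul 7 r r = r" "r \<in> alg7"
    using e r by (auto simp: primitive_idem_def idem_def)
  have ee': "mmul 7 e (mmul 7 e X) = mmul 7 e X" and rr': "mmul 7 r (mmul 7 r X) = mmul 7 r X"
    and ere': "mmul 7 r (mmul 7 e (mmul 7 r X)) = mmul 7 r X" for X
    using ee(1) rr(1) ere by (metis mmul_assoc)+
  have ere2: "mmul 7 r (mmul 7 e r) = r"
    using ere by (simp add: mmul_assoc)
  \<comment> \<open>Since \<open>r e r = r\<close>, the element \<open>e r e\<close> is an
    idempotent below \<open>e\<close>, so primitivity leaves only 0 and \<open>e\<close>. It is not
    0, because multiplying it by \<open>r\<close> on both sides gives back \<open>r\<close>.\<close>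
  define g where "g = mmul 7 e (mmul 7 r e)"
  have g: "g \<in> alg7" "e - g \<in> alg7"
    unfolding g_def using ee(2) rr(2) by (auto intro!: A7.diff_A A7.mmul_A)
  have gg: "mmul 7 g g = g" "mmul 7 e g = g" "mmul 7 g e = g"
    unfolding g_def using ee rr by (simp_all add: mmul_assoc ee' ere')
  have "idem 7 alg7 g" "idem 7 alg7 (e - g)" "mmul 7 g (e - g) = 0" "mmul 7 (e - g) g = 0" "e = g + (e - g)"
    using g gg ee by (auto simp: idem_def mmul_diff_left mmul_diff_right)
  then have "g = 0 \<or> e - g = 0"
    using e unfolding primitive_idem_def by blast
  moreover have "g \<noteq> 0"
  proof
    assume "g = 0"
    then have "mmul 7 r (mmul 7 g r) = 0" by simp
    then show False
      using r(2) by (simp add: g_def mmul_assoc ere' ere2)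
  qed
  ultimately have g_eq: "g = e" by simp
  show ?thesis
    unfolding proj_iso_def
  proof (intro exI conjI)
    show "mmul 7 e r \<in> alg7" "mmul 7 r e \<in> alg7"
      using ee(2) rr(2) by (auto intro!: A7.mmul_A)
    show "mmul 7 (mmul 7 e r) (mmul 7 r e) = e"
      using g_eq by (simp add: g_def mmul_assoc rr')
    show "mmul 7 (mmul 7 r e) (mmul 7 e r) = r"
      by (simp add: mmul_assoc ee' ere2)
  qed (simp_all add: mmul_assoc ee rr ee' rr')
qed

text \<open>The diagonal coefficients of an idempotent are 0 or 1. If all are 0 it is nilpotent,
  hence 0; a coefficient 1 selects the representative to which \<open>proj_iso_primitive\<close>
  applies.\<close>

lemma complete_reps_reps: "complete_reps 7 alg7 (reps :: 'k::field sq list)"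
  unfolding complete_reps_def
proof (intro conjI allI impI)
  fix e :: "'k sq"
  assume p: "primitive_idem 7 alg7 e"
  then have eA: "e \<in> alg7" and ee: "mmul 7 e e = e" and nz: "e \<noteq> 0"
    by (auto simp: primitive_idem_def idem_def)
  obtain a b c v w u where e: "e = mk a b c v w u"
    using eA by (auto simp: alg7_def)
  have abc: "a = 0 \<or> a = 1" "b = 0 \<or> b = 1" "c = 0 \<or> c = 1"
    using ee by (auto simp: e mk_mult mk_eq_iff intro: idem_scalar)
  have "\<not> (a = 0 \<and> b = 0 \<and> c = 0)"
  proof
    assume "a = 0 \<and> b = 0 \<and> c = 0"
    then have "e = 0"
      using ee by (auto simp: e mk_mult mk_eq_iff mk_eq_0_iff cross_def)
    then show False using nz by blast
  qed
  then obtain i where i: "i < length (reps :: 'k sq list)" "mmul 7 (mmul 7 (reps ! i) e) (reps ! i) = reps ! i"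
  proof (rule_tac disjE[of "a = 1" "b = 1 \<or> c = 1"]; (elim disjE)?)
    assume "a = 1"
    then show thesis
      using that[of 0] by (simp add: length_reps reps_nth e mk_mult mk_eq_iff cross_def)
  next
    assume "b = 1"
    then show thesis
      using that[of "Suc 0"] by (simp add: length_reps reps_nth e mk_mult mk_eq_iff cross_def)
  next
    assume "c = 1"
    then show thesis
      using that[of 2] by (simp add: length_reps reps_nth e mk_mult mk_eq_iff cross_def)
  qed (use abc in auto)
  then show "\<exists>i<length (reps :: 'k sq list). proj_iso 7 alg7 e (reps ! i)"
    using proj_iso_primitive[OF p idem_reps[OF i(1)] A7.nonzero[OF i(1)] i(2)] by blast
next
  fix i j assume "i < length (reps :: 'k sq list)" "j < length (reps :: 'k sq list)" "i \<noteq> j"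
  then show "\<not> proj_iso 7 alg7 (reps ! i :: 'k sq) (reps ! j)"
    by (rule not_proj_iso_reps)
qed (rule primitive_idem_reps)

section \<open>Triples of two by two matrices\<close>

lemma all_less_2: "(\<forall>i<(2::nat). P i) \<longleftrightarrow> P 0 \<and> P (Suc 0)"
  by (auto simp: less_2_cases_iff)

lemma mmul_2: "mmul 2 X Y i j = X i 0 * Y 0 j + X i (Suc 0) * Y (Suc 0) j"
  by (simp add: mmul_def numeral_2_eq_2)

lemma munit_supp: "munit N \<in> supp_sq N"
  by (auto simp: munit_def supp_sq_def)

lemma diff_supp: "X \<in> supp_sq N \<Longrightarrow> Y \<in> supp_sq N \<Longrightarrow> X - Y \<in> supp_sq N"
  for X Y :: "'k::ring sq"
  by (auto simp: supp_sq_def)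

lemma add_supp: "X \<in> supp_sq N \<Longrightarrow> Y \<in> supp_sq N \<Longrightarrow> X + Y \<in> supp_sq N"
  for X Y :: "'k::ring sq"
  by (auto simp: supp_sq_def)

lemma msc_supp: "X \<in> supp_sq N \<Longrightarrow> msc c X \<in> supp_sq N"
  for X :: "'k::ring sq"
  by (auto simp: supp_sq_def msc_def)

lemma munit_mmul: "mmul N (munit N) X = X" and mmul_munit: "mmul N X (munit N) = X"
  if "X \<in> supp_sq N" for X :: "'k::field sq"
proof -
  have "mmul N (munit N) X i j = (\<Sum>l<N. if l = i then X i j else 0)"
    "mmul N X (munit N) i j = (\<Sum>l<N. if l = j then X i j else 0)" for i j
    unfolding mmul_def munit_def by (intro sum.cong; auto)+
  then show "mmul N (munit N) X = X" "mmul N X (munit N) = X"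
    using that by (auto simp: fun_eq_iff supp_sq_def)
qed

definition det2 :: "'k::field sq \<Rightarrow> 'k" where
  "det2 X = X 0 0 * X 1 1 - X 0 1 * X 1 0"

definition adj2 :: "'k::field sq \<Rightarrow> 'k sq" where
  "adj2 X = (\<lambda>i j. if i = 0 \<and> j = 0 then X 1 1 else if i = 0 \<and> j = 1 then - X 0 1
     else if i = 1 \<and> j = 0 then - X 1 0 else if i = 1 \<and> j = 1 then X 0 0 else 0)"

lemma adj2_supp: "adj2 X \<in> supp_sq 2"
  by (auto simp: adj2_def supp_sq_def)

lemma mmul_adj2:
  assumes "X \<in> supp_sq 2"
  shows "mmul 2 X (adj2 X) = msc (det2 X) (munit 2)" "mmul 2 (adj2 X) X = msc (det2 X) (munit 2)"
proof -
  show "mmul 2 X (adj2 X) = msc (det2 X) (munit 2)"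
    by (rule supp_sq_eqI[of _ 2])
      (simp_all add: assms mmul_supp msc_supp munit_supp adj2_supp all_less_2 mmul_2,
       simp_all add: adj2_def msc_def munit_def det2_def algebra_simps)
  show "mmul 2 (adj2 X) X = msc (det2 X) (munit 2)"
    by (rule supp_sq_eqI[of _ 2])
      (simp_all add: assms mmul_supp msc_supp munit_supp adj2_supp all_less_2 mmul_2,
       simp_all add: adj2_def msc_def munit_def det2_def algebra_simps)
qed

lemma msc_msc: "msc c (msc d X) = msc (c * d) X" for X :: "'k::field sq"
  by (simp add: msc_def mult.assoc)

lemma msc_1: "msc 1 X = X" for X :: "'k::field sq"
  by (simp add: msc_def)

lemma det2_inverse:
  assumes "X \<in> supp_sq 2" "det2 X \<noteq> 0"
  shows "mmul 2 X (msc (1 / det2 X) (adj2 X)) = munit 2" "mmul 2 (msc (1 / det2 X) (adj2 X)) X = munit 2"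
  using assms by (simp_all add: mmul_msc_left mmul_msc_right mmul_adj2 msc_msc msc_1)

text \<open>The centralizer of a non-scalar 2x2 matrix consists of the polynomials in it. In
  coordinates: the vectors \<open>(x, B 0 1, B 1 0)\<close> and \<open>(x', B' 0 1, B' 1 0)\<close>
  are both multiples of the nonzero \<open>(p, q, r)\<close>.\<close>

lemma commutant_commutes:
  fixes C B B' :: "'k::field sq"
  assumes s: "B \<in> supp_sq 2" "B' \<in> supp_sq 2"
    and c: "mmul 2 C B = mmul 2 B C" "mmul 2 C B' = mmul 2 B' C"
    and ns: "\<not> (C 0 1 = 0 \<and> C 1 0 = 0 \<and> C 0 0 = C 1 1)"
  shows "mmul 2 B B' = mmul 2 B' B"
proof -
  define p q r where "p = C 0 0 - C 1 1" and "q = C 0 1" and "r = C 1 0"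
  define x where "x = B 0 0 - B 1 1"
  define x' where "x' = B' 0 0 - B' 1 1"
  have "mmul 2 C B i j = mmul 2 B C i j" "mmul 2 C B' i j = mmul 2 B' C i j" for i j
    using c by simp_all
  from this(1)[of 0 0] this(1)[of 0 1] this(1)[of 1 0] this(2)[of 0 0] this(2)[of 0 1] this(2)[of 1 0]
  have e: "q * B 1 0 = r * B 0 1" "p * B 0 1 = q * x" "p * B 1 0 = r * x"
      "q * B' 1 0 = r * B' 0 1" "p * B' 0 1 = q * x'" "p * B' 1 0 = r * x'"
    by (simp_all add: mmul_2 p_def q_def r_def x_def x'_def algebra_simps)
  have "p \<noteq> 0 \<or> q \<noteq> 0 \<or> r \<noteq> 0"
    using ns by (auto simp: p_def q_def r_def)
  \<comment> \<open>These are the 2x2 minors of the two parallel vectors. Each follows from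
    \<open>e\<close> after multiplication by a suitable power of the nonzero component.\<close>
  then have z: "B 0 1 * B' 1 0 = B' 0 1 * B 1 0 \<and> x * B' 0 1 = x' * B 0 1 \<and> x * B' 1 0 = x' * B 1 0"
  proof (elim disjE)
    assume n: "p \<noteq> 0"
    have "p * (p * (B 0 1 * B' 1 0)) = p * (p * (B' 0 1 * B 1 0))" "p * (x * B' 0 1) = p * (x' * B 0 1)"
      "p * (x * B' 1 0) = p * (x' * B 1 0)"
      using e by algebra+
    then show ?thesis using n by simp
  next
    assume n: "q \<noteq> 0"
    have "q * (B 0 1 * B' 1 0) = q * (B' 0 1 * B 1 0)" "q * (x * B' 0 1) = q * (x' * B 0 1)"
      "q * (q * (x * B' 1 0)) = q * (q * (x' * B 1 0))"
      using e by algebra+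
    then show ?thesis using n by simp
  next
    assume n: "r \<noteq> 0"
    have "r * (B 0 1 * B' 1 0) = r * (B' 0 1 * B 1 0)" "r * (r * (x * B' 0 1)) = r * (r * (x' * B 0 1))"
      "r * (x * B' 1 0) = r * (x' * B 1 0)"
      using e by algebra+
    then show ?thesis using n by simp
  qed
  show ?thesis
    by (rule supp_sq_eqI[of _ 2])
      (use z in \<open>simp_all add: s mmul_supp all_less_2 mmul_2 x_def x'_def algebra_simps\<close>)
qed

text \<open>Multiplied by \<open>I\<close> on the right, this is the commutator of
  \<open>A1 I\<close> and \<open>A2 I\<close>.\<close>

definition pencil :: "'k::field sq \<Rightarrow> 'k sq \<Rightarrow> 'k sq \<Rightarrow> 'k sq \<Rightarrow> 'k sq" where
  "pencil I A0 A1 A2 = mmul 2 A1 (mmul 2 I A2) - mmul 2 A2 (mmul 2 I A1)"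

text \<open>An endomorphism \<open>(C, D)\<close> of the triple is determined by \<open>C\<close>, which commutes with
\<open>A1 I\<close> and \<open>A2 I\<close>; were it not scalar, these two would commute with each other.\<close>

lemma triple_idem:
  fixes C :: "'k::field sq"
  assumes s: "A0 \<in> supp_sq 2" "A1 \<in> supp_sq 2" "A2 \<in> supp_sq 2" "I \<in> supp_sq 2" "C \<in> supp_sq 2" "D \<in> supp_sq 2"
    and I: "mmul 2 A0 I = munit 2" "mmul 2 I A0 = munit 2"
    and J: "mmul 2 (pencil I A0 A1 A2) J = munit 2"
    and h: "mmul 2 A0 D = mmul 2 C A0" "mmul 2 A1 D = mmul 2 C A1" "mmul 2 A2 D = mmul 2 C A2"
    and idem: "mmul 2 C C = C"
  shows "C = 0 \<and> D = 0 \<or> C = munit 2 \<and> D = munit 2"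
proof -
  have ID: "mmul 2 I (mmul 2 A0 X) = X" "mmul 2 A0 (mmul 2 I X) = X" if "X \<in> supp_sq 2" for X
    using I that by (simp_all flip: mmul_assoc add: munit_mmul)
  have D: "D = mmul 2 I (mmul 2 C A0)"
    using ID(1)[OF s(6)] h(1) by simp
  have DI: "mmul 2 D I = mmul 2 I C"
    by (simp add: D mmul_assoc I mmul_munit s)
  have comm: "mmul 2 C (mmul 2 B I) = mmul 2 (mmul 2 B I) C" if "mmul 2 B D = mmul 2 C B" for B
    using that DI by (metis mmul_assoc)
  have sc: "C 0 1 = 0 \<and> C 1 0 = 0 \<and> C 0 0 = C 1 1"
  proof (rule ccontr)
    assume "\<not> ?thesis"
    \<comment> \<open>The commutator of \<open>A1 I\<close> and \<open>A2 I\<close> would be 0;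
      multiplying it by \<open>A0\<close> cancels the last \<open>I\<close> and leaves the
      invertible pencil.\<close>
    from commutant_commutes[OF mmul_supp[OF s(2,4)] mmul_supp[OF s(3,4)] comm[OF h(2)] comm[OF h(3)] this]
    have "mmul 2 (mmul 2 (pencil I A0 A1 A2) I) A0 = 0"
      by (simp add: pencil_def mmul_diff_left mmul_assoc)
    then have "pencil I A0 A1 A2 = 0"
      using s by (simp add: mmul_assoc I mmul_munit pencil_def diff_supp mmul_supp)
    then have "munit 2 = (0 :: 'k sq)"
      using J by simp
    then have "munit 2 0 0 = (0 :: 'k)" by simp
    then show False by (simp add: munit_def)
  qed
  have "mmul 2 C C 0 0 = C 0 0"
    using idem by simp
  then have "C 0 0 * C 0 0 = C 0 0"
    using sc by (simp add: mmul_2)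
  then consider "C 0 0 = 0" | "C 0 0 = 1"
    using idem_scalar by blast
  then show ?thesis
  proof cases
    case 1
    then have "C = 0"
      by (intro supp_sq_eqI[of _ 2]) (use sc s in \<open>auto simp: all_less_2 supp_sq_def\<close>)
    then show ?thesis by (simp add: D)
  next
    case 2
    then have "C = munit 2"
      by (intro supp_sq_eqI[of _ 2]) (use sc s in \<open>auto simp: all_less_2 supp_sq_def munit_def\<close>)
    then show ?thesis by (simp add: D munit_mmul s I)
  qed
qed

text \<open>Eliminating \<open>X1\<close> and \<open>X2\<close> by means of \<open>I\<close> leaves one equation for \<open>X0\<close>, with matrix
\<open>pencil I A0 A1 A2\<close>.\<close>

lemma triple_solve:
  fixes A0 :: "'k::field sq"
  assumes s: "A0 \<in> supp_sq 2" "A1 \<in> supp_sq 2" "A2 \<in> supp_sq 2" "I \<in> supp_sq 2" "J \<in> supp_sq 2"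
    and I: "mmul 2 A0 I = munit 2" "mmul 2 I A0 = munit 2"
    and J: "mmul 2 (pencil I A0 A1 A2) J = munit 2"
    and Y: "Y0 \<in> supp_sq 2" "Y1 \<in> supp_sq 2" "Y2 \<in> supp_sq 2"
  obtains X0 X1 X2 where
    "mmul 2 A1 X2 - mmul 2 A2 X1 = Y0"
    "mmul 2 A2 X0 - mmul 2 A0 X2 = Y1"
    "mmul 2 A0 X1 - mmul 2 A1 X0 = Y2"
proof -
  have A0I: "mmul 2 A0 (mmul 2 I X) = X" if "X \<in> supp_sq 2" for X
    using I that by (simp flip: mmul_assoc add: munit_mmul)
  define R where "R = Y0 + mmul 2 A1 (mmul 2 I Y1) + mmul 2 A2 (mmul 2 I Y2)"
  define X0 where "X0 = mmul 2 J R"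
  define X1 where "X1 = mmul 2 I (Y2 + mmul 2 A1 X0)"
  define X2 where "X2 = mmul 2 I (mmul 2 A2 X0 - Y1)"
  have R: "R \<in> supp_sq 2" and X0: "X0 \<in> supp_sq 2"
    unfolding R_def X0_def using s Y by (auto intro!: add_supp mmul_supp)
  have "mmul 2 (pencil I A0 A1 A2) X0 = R"
    using J R by (simp add: X0_def munit_mmul flip: mmul_assoc)
  then have "mmul 2 A1 (mmul 2 I (mmul 2 A2 X0)) - mmul 2 A2 (mmul 2 I (mmul 2 A1 X0)) =
      Y0 + mmul 2 A1 (mmul 2 I Y1) + mmul 2 A2 (mmul 2 I Y2)"
    by (simp add: pencil_def mmul_diff_left mmul_assoc R_def)
  then have "mmul 2 A1 X2 - mmul 2 A2 X1 = Y0"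
    by (simp add: X1_def X2_def mmul_diff_right mmul_add_right algebra_simps)
  moreover have "mmul 2 A2 X0 - mmul 2 A0 X2 = Y1"
    using s Y X0 by (simp add: X2_def A0I diff_supp mmul_supp)
  moreover have "mmul 2 A0 X1 - mmul 2 A1 X0 = Y2"
    using s Y X0 by (simp add: X1_def A0I add_supp mmul_supp)
  ultimately show thesis by (rule that)
qed

text \<open>The adjugate replaces the inverse to keep the expression polynomial. As the pencil is
  linear in \<open>I\<close>, this only scales it by \<open>det2 A0\<close>, which the first factor
  keeps away from 0.\<close>

definition gen_poly :: "'k::field sq \<Rightarrow> 'k sq \<Rightarrow> 'k sq \<Rightarrow> 'k" where
  "gen_poly A0 A1 A2 = det2 A0 * det2 (pencil (adj2 A0) A0 A1 A2)"

lemma gen_poly_inverses: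
  assumes s: "A0 \<in> supp_sq 2" "A1 \<in> supp_sq 2" "A2 \<in> supp_sq 2" and g: "gen_poly A0 A1 A2 \<noteq> 0"
  obtains I J where "I \<in> supp_sq 2" "J \<in> supp_sq 2"
    "mmul 2 A0 I = munit 2" "mmul 2 I A0 = munit 2" "mmul 2 (pencil I A0 A1 A2) J = munit 2"
proof -
  define I where "I = msc (1 / det2 A0) (adj2 A0)"
  define P where "P = pencil (adj2 A0) A0 A1 A2"
  have d: "det2 A0 \<noteq> 0" "det2 P \<noteq> 0"
    using g by (auto simp: gen_poly_def P_def)
  have P: "P \<in> supp_sq 2"
    unfolding P_def pencil_def using s by (intro diff_supp mmul_supp adj2_supp)
  have "pencil I A0 A1 A2 = msc (1 / det2 A0) P"
    unfolding I_def P_def pencil_def mmul_msc_left mmul_msc_right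
    by (simp add: msc_def fun_eq_iff right_diff_distrib)
  then have "mmul 2 (pencil I A0 A1 A2) (msc (det2 A0) (msc (1 / det2 P) (adj2 P))) = munit 2"
    using det2_inverse(1)[OF P d(2)] d(1) by (simp add: mmul_msc_left mmul_msc_right msc_msc msc_1)
  moreover have "mmul 2 A0 I = munit 2" "mmul 2 I A0 = munit 2"
    unfolding I_def using det2_inverse[OF s(1) d(1)] by simp_all
  moreover have "I \<in> supp_sq 2" "msc (det2 A0) (msc (1 / det2 P) (adj2 P)) \<in> supp_sq 2"
    unfolding I_def by (intro msc_supp adj2_supp)+
  ultimately show thesis using that by blast
qed

section \<open>The three classes\<close>

lemma hcomp_singleton: "hcomp N [x] f g s r = mmul N (f s 0) (g 0 r)"
  by (simp add: hcomp_def)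

lemma hcomp_pair: "hcomp N [x, y] f g s r = mmul N (f s 0) (g 0 r) + mmul N (f s (Suc 0)) (g (Suc 0) r)"
  by (simp add: hcomp_def)

lemma homs_entry:
  fixes \<phi> :: "'k::field hm"
  assumes "\<phi> \<in> homs 7 alg7 reps L M" "s < length L" "r < length M"
  shows "L ! s = 0 \<Longrightarrow> M ! r = 0 \<Longrightarrow> \<phi> s r = mk (\<phi> s r 0 0) 0 0 0 0 0"
    "L ! s = 0 \<Longrightarrow> M ! r = Suc 0 \<Longrightarrow> \<phi> s r = mk 0 0 0 (vco (\<phi> s r)) 0 0"
    "L ! s = 0 \<Longrightarrow> M ! r = 2 \<Longrightarrow> \<phi> s r = mk 0 0 0 0 0 (uco (\<phi> s r))"
    "L ! s = Suc 0 \<Longrightarrow> M ! r = 0 \<Longrightarrow> \<phi> s r = 0"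
    "L ! s = Suc 0 \<Longrightarrow> M ! r = Suc 0 \<Longrightarrow> \<phi> s r = mk 0 (\<phi> s r 3 3) 0 0 0 0"
    "L ! s = Suc 0 \<Longrightarrow> M ! r = 2 \<Longrightarrow> \<phi> s r = mk 0 0 0 0 (wco (\<phi> s r)) 0"
    "L ! s = 2 \<Longrightarrow> M ! r = 0 \<Longrightarrow> \<phi> s r = 0"
    "L ! s = 2 \<Longrightarrow> M ! r = Suc 0 \<Longrightarrow> \<phi> s r = 0"
    "L ! s = 2 \<Longrightarrow> M ! r = 2 \<Longrightarrow> \<phi> s r = mk 0 0 (\<phi> s r 6 6) 0 0 0"
  using homsD(2)[OF assms, symmetric] corner[OF homsD(1)[OF assms]] by metis+

lemma homs_eqI:
  assumes "\<phi> \<in> homs N A E L M" "\<psi> \<in> homs N A E L M"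
    and "\<And>s r. s < length L \<Longrightarrow> r < length M \<Longrightarrow> \<phi> s r = \<psi> s r"
  shows "\<phi> = \<psi>"
proof (intro ext)
  fix s r i j
  show "\<phi> s r i j = \<psi> s r i j"
    using assms(3)[of s r] homsD(3)[OF assms(1), of s r] homsD(3)[OF assms(2), of s r]
    by (cases "s < length L \<and> r < length M") auto
qed

lemma mk_V_mult: "mmul 7 (mk 0 0 0 v 0 0) (mk 0 b 0 0 0 0) = mk 0 0 0 (\<lambda>i. v i * b) 0 0"
  "mmul 7 (mk a 0 0 0 0 0) (mk 0 0 0 v 0 0) = mk 0 0 0 (\<lambda>i. a * v i) 0 0"
  "mmul 7 (mk 0 0 0 v 0 0) (mk 0 0 0 0 w 0) = mk 0 0 0 0 0 (cross v w)"
  by (simp_all add: mk_mult mk_eq_iff cross_def)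

text \<open>Here \<open>f = (v, u)\<close>, and \<open>v . u \<noteq> 0\<close> says that \<open>v\<close> is nonzero and that \<open>u\<close> lies
outside the plane \<open>cross v W\<close>.\<close>

lemma indec_mixed:
  fixes f :: "'k::field hm"
  assumes f: "f \<in> homs 7 alg7 reps [0] [Suc 0, 2]"
    and dot: "vco (f 0 0) 0 * uco (f 0 1) 0 + vco (f 0 0) 1 * uco (f 0 1) 1 + vco (f 0 0) 2 * uco (f 0 1) 2 \<noteq> 0"
  shows "indec_cplx 7 alg7 reps ([0], [Suc 0, 2], f)"
proof (rule A7.indec_cplxI)
  let ?X = "([0], [Suc 0, 2], f)"
  show X: "is_cplx 7 alg7 reps ?X"
    using f by (simp add: is_cplx_def length_reps)
  show "h = 0" if h: "h \<in> homs 7 alg7 reps [Suc 0, 2] [0]" for h :: "'k hm"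
    using homs_entry(4,7)[OF h] by (intro homs_eqI[OF h A7.homs_zero]) (auto simp: less_Suc_eq)
  have "hid reps [0] 0 0 \<noteq> (0 :: 'k sq)"
    by (simp add: hid_def reps_nth mk_eq_0_iff)
  then show "cid reps ?X \<noteq> (0 :: 'k hm \<times> 'k hm)"
    by (auto simp: cid_def zero_prod_def)
  fix a :: "'k hm \<times> 'k hm"
  assume a: "chain_map 7 alg7 reps ?X ?X a" and aa: "ccomp 7 ?X a a = a"
  obtain c d where cd: "a = (c, d)" by (cases a)
  have c: "c \<in> homs 7 alg7 reps [0] [0]" and d: "d \<in> homs 7 alg7 reps [Suc 0, 2] [Suc 0, 2]"
    and comm: "hcomp 7 [Suc 0, 2] f d = hcomp 7 [0] c f"
    using a by (auto simp: chain_map_def cd)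
  have cc: "hcomp 7 [0] c c = c" and dd: "hcomp 7 [Suc 0, 2] d d = d"
    using aa by (auto simp: ccomp_def cd)
  define v where "v = vco (f 0 0)"
  define u where "u = uco (f 0 1)"
  define w where "w = wco (d 0 1)"
  define p q r where "p = c 0 0 0 0" and "q = d 0 0 3 3" and "r = d 1 1 6 6"
  have f00: "f 0 0 = mk 0 0 0 v 0 0" unfolding v_def by (rule homs_entry(2)[OF f]) simp_all
  have f01: "f 0 (Suc 0) = mk 0 0 0 0 0 u" unfolding u_def One_nat_def by (rule homs_entry(3)[OF f]) simp_all
  have c00: "c 0 0 = mk p 0 0 0 0 0" unfolding p_def by (rule homs_entry(1)[OF c]) simp_all
  have d00: "d 0 0 = mk 0 q 0 0 0 0" unfolding q_def by (rule homs_entry(5)[OF d]) simp_all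
  have d01: "d 0 (Suc 0) = mk 0 0 0 0 w 0" unfolding w_def One_nat_def by (rule homs_entry(6)[OF d]) simp_all
  have d10: "d (Suc 0) 0 = 0" by (rule homs_entry(8)[OF d]) simp_all
  have d11: "d (Suc 0) (Suc 0) = mk 0 0 r 0 0 0" unfolding r_def One_nat_def by (rule homs_entry(9)[OF d]) simp_all
  have "hcomp 7 [Suc 0, 2] f d 0 0 = hcomp 7 [0] c f 0 0" using comm by simp
  then have v: "v 0 * q = p * v 0" "v 1 * q = p * v 1" "v 2 * q = p * v 2"
    by (simp_all add: hcomp_singleton hcomp_pair f00 f01 c00 d00 d10 mk_mult mk_eq_iff)
  have "hcomp 7 [Suc 0, 2] f d 0 (Suc 0) = hcomp 7 [0] c f 0 (Suc 0)" using comm by simp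
  then have u: "v 1 * w 2 - v 2 * w 1 + u 0 * r = p * u 0" "v 2 * w 0 - v 0 * w 2 + u 1 * r = p * u 1"
      "v 0 * w 1 - v 1 * w 0 + u 2 * r = p * u 2"
    by (simp_all add: hcomp_singleton hcomp_pair f00 f01 c00 d01 d11 mk_mult mk_add mk_eq_iff cross_def)
  have dot': "v 0 * u 0 + v 1 * u 1 + v 2 * u 2 \<noteq> 0"
    using dot by (simp add: v_def u_def)
  \<comment> \<open>Pairing the equations \<open>u\<close> with \<open>v\<close> removes the cross
    product, which is orthogonal to \<open>v\<close>.\<close>
  have "(v 0 * u 0 + v 1 * u 1 + v 2 * u 2) * r = (v 0 * u 0 + v 1 * u 1 + v 2 * u 2) * p"
    using u by algebra
  then have r: "r = p" using dot' by simp
  have "v 0 \<noteq> 0 \<or> v 1 \<noteq> 0 \<or> v 2 \<noteq> 0" using dot' by auto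
  then have q: "q = p" using v by (auto simp: mult.commute)
  have "hcomp 7 [0] c c 0 0 = c 0 0" using cc by simp
  then have "p * p = p"
    by (simp add: hcomp_singleton c00 mk_mult mk_eq_iff)
  then have p: "p = 0 \<or> p = 1" by (rule idem_scalar)
  have "hcomp 7 [Suc 0, 2] d d 0 (Suc 0) = d 0 (Suc 0)" using dd by simp
  then have "p * w 0 + w 0 * p = w 0" "p * w 1 + w 1 * p = w 1" "p * w 2 + w 2 * p = w 2"
    by (simp_all add: hcomp_pair d00 d01 d11 q r mk_mult mk_add mk_eq_iff cross_def)
  \<comment> \<open>For \<open>p = 1\<close> the equation reads \<open>x + x = x\<close>, so it
    forces 0 in every characteristic.\<close>
  moreover have "x = 0" if "p * x + x * p = x" for x
    using p that by (elim disjE) (simp, metis mult_1 mult_1_right add_cancel_right_right)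
  ultimately have w: "w 0 = 0" "w 1 = 0" "w 2 = 0"
    by blast+
  have d01': "d 0 (Suc 0) = 0" using w by (simp add: d01 mk_eq_0_iff)
  show "a = 0 \<or> a = cid reps ?X"
  proof (cases "p = 0")
    case True
    have "c = 0"
      by (rule homs_eqI[OF c A7.homs_zero]) (simp add: c00 True mk_0)
    moreover have "d = 0"
      by (rule homs_eqI[OF d A7.homs_zero]) (auto simp: less_Suc_eq d00 d01' d10 d11 q r True mk_0)
    ultimately show ?thesis by (simp add: cd zero_prod_def)
  next
    case False
    then have [simp]: "p = 1" using p by simp
    have "c = hid reps [0]"
      by (rule homs_eqI[OF c A7.hid_homs(1)]) (simp_all add: A7.valid_def length_reps c00 hid_def reps_nth)
    moreover have "d = hid reps [Suc 0, 2]"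
      by (rule homs_eqI[OF d A7.hid_homs(1)])
        (auto simp: A7.valid_def length_reps less_Suc_eq d00 d01' d10 d11 q r hid_def reps_nth)
    ultimately show ?thesis by (simp add: cd cid_def)
  qed
qed

definition Vmat :: "'k::field hm \<Rightarrow> nat \<Rightarrow> 'k sq" where
  "Vmat f i = (\<lambda>s r. if s < 2 \<and> r < 2 then vco (f s r) i else 0)"

text \<open>The columns are shifted by two because the copies of vertex 2 follow the two copies of
  vertex 1 in the target.\<close>

definition Umat :: "'k::field hm \<Rightarrow> nat \<Rightarrow> 'k sq" where
  "Umat f i = (\<lambda>s r. if s < 2 \<and> r < 2 then uco (f s (Suc (Suc r))) i else 0)"

lemma Vmat_supp: "Vmat f i \<in> supp_sq 2"
  by (auto simp: Vmat_def supp_sq_def)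

text \<open>Up to a power of \<open>det2 A0\<close>, the pencil is a Schur complement of the \<open>6 \<times> 6\<close> matrix of
\<open>X \<mapsto> cross V X\<close>, so that \<open>gen f \<noteq> 0\<close> makes this map bijective.\<close>

definition gen :: "'k::field hm \<Rightarrow> 'k" where
  "gen f = gen_poly (Vmat f 0) (Vmat f 1) (Vmat f 2)"

text \<open>Such an \<open>f\<close> is a triple of scalar 2x2 matrices, a representation of the
  Kronecker quiver with three arrows of dimension (2, 2). Its chain endomorphisms are the pairs
  \<open>(C, D)\<close> of \<open>triple_idem\<close>.\<close>

lemma indec_kronecker:
  fixes f :: "'k::field hm"
  assumes f: "f \<in> homs 7 alg7 reps [0, 0] [Suc 0, Suc 0]" and g: "gen f \<noteq> 0"
  shows "indec_cplx 7 alg7 reps ([0, 0], [Suc 0, Suc 0], f)"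
proof (rule A7.indec_cplxI)
  let ?X = "([0, 0], [Suc 0, Suc 0], f)"
  show X: "is_cplx 7 alg7 reps ?X"
    using f by (simp add: is_cplx_def length_reps)
  show "h = 0" if h: "h \<in> homs 7 alg7 reps [Suc 0, Suc 0] [0, 0]" for h :: "'k hm"
    using homs_entry(4)[OF h] by (intro homs_eqI[OF h A7.homs_zero]) (auto simp: less_Suc_eq)
  have "hid reps [0, 0] 0 0 \<noteq> (0 :: 'k sq)"
    by (simp add: hid_def reps_nth mk_eq_0_iff)
  then show "cid reps ?X \<noteq> (0 :: 'k hm \<times> 'k hm)"
    by (auto simp: cid_def zero_prod_def)
  fix a :: "'k hm \<times> 'k hm"
  assume a: "chain_map 7 alg7 reps ?X ?X a" and aa: "ccomp 7 ?X a a = a"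
  obtain c d where cd: "a = (c, d)" by (cases a)
  have c: "c \<in> homs 7 alg7 reps [0, 0] [0, 0]" and d: "d \<in> homs 7 alg7 reps [Suc 0, Suc 0] [Suc 0, Suc 0]"
    and comm: "hcomp 7 [Suc 0, Suc 0] f d = hcomp 7 [0, 0] c f"
    using a by (auto simp: chain_map_def cd)
  have cc: "hcomp 7 [0, 0] c c = c"
    using aa by (auto simp: ccomp_def cd)
  define C :: "'k sq" where "C = (\<lambda>s r. c s r 0 0)"
  define D :: "'k sq" where "D = (\<lambda>s r. d s r 3 3)"
  have C: "C \<in> supp_sq 2" and D: "D \<in> supp_sq 2"
    using homsD(3)[OF c] homsD(3)[OF d] by (auto simp: supp_sq_def C_def D_def)
  have ce: "c s r = mk (C s r) 0 0 0 0 0" if "s < 2" "r < 2" for s r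
    unfolding C_def using that by (intro homs_entry(1)[OF c]) (auto simp: less_2_cases_iff)
  have de: "d s r = mk 0 (D s r) 0 0 0 0" if "s < 2" "r < 2" for s r
    unfolding D_def using that by (intro homs_entry(5)[OF d]) (auto simp: less_2_cases_iff)
  have fe: "f s r = mk 0 0 0 (\<lambda>i. Vmat f i s r) 0 0" if "s < 2" "r < 2" for s r
    using that homs_entry(2)[OF f, of s r] by (auto simp: Vmat_def less_2_cases_iff)
  have comm': "Vmat f i s 0 * D 0 r + Vmat f i s (Suc 0) * D (Suc 0) r =
      C s 0 * Vmat f i 0 r + C s (Suc 0) * Vmat f i (Suc 0) r"
    if "s < 2" "r < 2" "i < 3" for s r i
  proof -
    have "hcomp 7 [Suc 0, Suc 0] f d s r = hcomp 7 [0, 0] c f s r" using comm by simp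
    then show ?thesis
      using that less_3_cases[OF that(3)] by (auto simp: hcomp_pair ce de fe mk_V_mult mk_add mk_eq_iff)
  qed
  have comm'': "mmul 2 (Vmat f i) D = mmul 2 C (Vmat f i)" if "i < 3" for i
    by (rule supp_sq_eqI[of _ 2]) (simp_all add: mmul_supp Vmat_supp C D mmul_2 comm' that)
  have CC: "mmul 2 C C = C"
  proof (rule supp_sq_eqI[of _ 2])
    show "\<forall>s<2. \<forall>r<2. mmul 2 C C s r = C s r"
    proof (intro allI impI)
      fix s r :: nat assume sr: "s < 2" "r < 2"
      have "hcomp 7 [0, 0] c c s r = c s r" using cc by simp
      then show "mmul 2 C C s r = C s r"
        using sr by (simp add: hcomp_pair ce mk_mult mk_add mk_eq_iff mmul_2)
    qed
  qed (simp_all add: mmul_supp C)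
  obtain I J where IJ: "I \<in> supp_sq 2" "J \<in> supp_sq 2"
    "mmul 2 (Vmat f 0) I = munit 2" "mmul 2 I (Vmat f 0) = munit 2"
    "mmul 2 (pencil I (Vmat f 0) (Vmat f 1) (Vmat f 2)) J = munit 2"
    using gen_poly_inverses[OF Vmat_supp Vmat_supp Vmat_supp g[unfolded gen_def]] by blast
  have "C = 0 \<and> D = 0 \<or> C = munit 2 \<and> D = munit 2"
    by (rule triple_idem[OF Vmat_supp Vmat_supp Vmat_supp IJ(1) C D IJ(3-5) _ _ _ CC]) (simp_all add: comm'')
  then show "a = 0 \<or> a = cid reps ?X"
  proof (elim disjE conjE)
    assume z: "C = 0" "D = 0"
    have "c = 0"
      by (rule homs_eqI[OF c A7.homs_zero]) (simp add: ce z mk_0)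
    moreover have "d = 0"
      by (rule homs_eqI[OF d A7.homs_zero]) (simp add: de z mk_0)
    ultimately show ?thesis by (simp add: cd zero_prod_def)
  next
    assume z: "C = munit 2" "D = munit 2"
    have "c = hid reps [0, 0]"
      by (rule homs_eqI[OF c A7.hid_homs(1)])
        (auto simp: A7.valid_def length_reps ce z munit_def hid_def reps_nth mk_0 less_Suc_eq)
    moreover have "d = hid reps [Suc 0, Suc 0]"
      by (rule homs_eqI[OF d A7.hid_homs(1)])
        (auto simp: A7.valid_def length_reps de z munit_def hid_def reps_nth mk_0 less_Suc_eq)
    ultimately show ?thesis by (simp add: cd cid_def)
  qed
qed

lemma indec_stalk: "indec_cplx 7 alg7 reps ([], [2], 0 :: 'k::field hm)"
proof (rule A7.indec_cplxI)
  let ?X = "([], [2], 0 :: 'k hm)"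
  show X: "is_cplx 7 alg7 reps ?X"
    by (simp add: is_cplx_def length_reps A7.homs_zero)
  show "h = 0" if h: "h \<in> homs 7 alg7 reps [2] []" for h :: "'k hm"
    by (rule homs_eqI[OF h A7.homs_zero]) simp
  have "hid reps [2] 0 0 \<noteq> (0 :: 'k sq)"
    by (simp add: hid_def reps_nth mk_eq_0_iff)
  then show "cid reps ?X \<noteq> (0 :: 'k hm \<times> 'k hm)"
    by (auto simp: cid_def zero_prod_def)
  fix a :: "'k hm \<times> 'k hm"
  assume a: "chain_map 7 alg7 reps ?X ?X a" and aa: "ccomp 7 ?X a a = a"
  obtain c d where cd: "a = (c, d)" by (cases a)
  have c: "c \<in> homs 7 alg7 reps [] []" and d: "d \<in> homs 7 alg7 reps [2] [2]"
    using a by (auto simp: chain_map_def cd)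
  have dd: "hcomp 7 [2] d d = d"
    using aa by (auto simp: ccomp_def cd)
  define p where "p = d 0 0 6 6"
  have d00: "d 0 0 = mk 0 0 p 0 0 0" unfolding p_def by (rule homs_entry(9)[OF d]) simp_all
  have "hcomp 7 [2] d d 0 0 = d 0 0" using dd by simp
  then have "p * p = p"
    by (simp add: hcomp_singleton d00 mk_mult mk_eq_iff)
  then have p: "p = 0 \<or> p = 1" by (rule idem_scalar)
  have "c = 0" "c = hid reps []"
    by (rule homs_eqI[OF c A7.homs_zero], simp) (rule homs_eqI[OF c A7.hid_homs(1)], simp_all add: A7.valid_def)
  moreover have "d = 0" if "p = 0"
    by (rule homs_eqI[OF d A7.homs_zero]) (simp add: d00 that mk_0)
  moreover have "d = hid reps [2]" if "p = 1"
    by (rule homs_eqI[OF d A7.hid_homs(1)]) (simp_all add: A7.valid_def length_reps d00 hid_def reps_nth that)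
  ultimately show "a = 0 \<or> a = cid reps ?X"
    using p by (auto simp: cd cid_def zero_prod_def)
qed

section \<open>The classes and their general members\<close>

definition Theta :: "nat \<Rightarrow> int" where
  "Theta = (\<lambda>i. if i = 0 then -1 else if i = 1 \<or> i = 2 then 1 else 0)"

definition kron :: "nat \<Rightarrow> int" where
  "kron = (\<lambda>i. if i = 0 then -2 else if i = 1 then 2 else 0)"

definition stalk :: "nat \<Rightarrow> int" where
  "stalk = (\<lambda>i. if i = 2 then 1 else 0)"

lemma upt_3: "[0..<3] = [0, Suc 0, 2]"
  by (simp add: upt_rec)

lemma class_lists:
  "neg_list 3 Theta = [0]" "pos_list 3 Theta = [Suc 0, 2]"
  "neg_list 3 kron = [0, 0]" "pos_list 3 kron = [Suc 0, Suc 0]"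
  "neg_list 3 stalk = []" "pos_list 3 stalk = [2]"
  "neg_list 3 (\<lambda>i. 2 * Theta i) = [0, 0]" "pos_list 3 (\<lambda>i. 2 * Theta i) = [Suc 0, Suc 0, 2, 2]"
  by (simp_all add: neg_list_def pos_list_def upt_3 Theta_def kron_def stalk_def numeral_2_eq_2)

lemma generalI_homs:
  fixes p :: "'k::alg_closed_field hm \<Rightarrow> 'k"
  assumes "p \<in> polyfun" "\<phi> \<in> homs 7 alg7 reps L M" "p \<phi> \<noteq> 0"
    and "\<And>f. f \<in> homs 7 alg7 reps L M \<Longrightarrow> p f \<noteq> 0 \<Longrightarrow> P f"
  shows "general (homs 7 alg7 reps L M) P"
  using A7.homs_line assms by (rule generalI)

lemma polyfun_uminus: "p \<in> polyfun \<Longrightarrow> (\<lambda>\<phi>. - p \<phi>) \<in> polyfun"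
  using pf_mult[OF pf_const[of "-1"], of p] by simp

lemma polyfun_diff: "p \<in> polyfun \<Longrightarrow> q \<in> polyfun \<Longrightarrow> (\<lambda>\<phi>. p \<phi> - q \<phi>) \<in> polyfun"
  using pf_add[OF _ polyfun_uminus, of p q] by simp

lemma polyfun_mmul_2:
  assumes "\<And>i j. (\<lambda>\<phi>. X \<phi> i j) \<in> polyfun" "\<And>i j. (\<lambda>\<phi>. Y \<phi> i j) \<in> polyfun"
  shows "(\<lambda>\<phi>. mmul 2 (X \<phi>) (Y \<phi>) i j) \<in> polyfun"
  unfolding mmul_2 by (intro pf_add pf_mult assms)

lemma polyfun_adj2:
  assumes "\<And>i j. (\<lambda>\<phi>. X \<phi> i j) \<in> polyfun"
  shows "(\<lambda>\<phi>. adj2 (X \<phi>) i j) \<in> polyfun"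
  unfolding adj2_def using assms polyfun_uminus[OF assms] pf_const
  by (cases "i = 0"; cases "i = 1"; cases "j = 0"; cases "j = 1") auto

lemma polyfun_det2:
  assumes "\<And>i j. (\<lambda>\<phi>. X \<phi> i j) \<in> polyfun"
  shows "(\<lambda>\<phi>. det2 (X \<phi>)) \<in> polyfun"
  unfolding det2_def by (intro polyfun_diff pf_mult assms)

lemma polyfun_vco: "(\<lambda>\<phi>. vco (\<phi> s r) i) \<in> polyfun"
  unfolding vco_def by (cases "i = 0"; cases "i = 1") (auto intro: pf_coord)

lemma polyfun_uco: "(\<lambda>\<phi>. uco (\<phi> s r) i) \<in> polyfun"
  unfolding uco_def by (rule pf_coord)

lemma polyfun_Vmat: "(\<lambda>\<phi>. Vmat \<phi> i s r) \<in> polyfun"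
  unfolding Vmat_def by (cases "s < 2 \<and> r < 2") (auto intro: polyfun_vco pf_const)

lemma polyfun_gen: "gen \<in> polyfun"
proof -
  have "(\<lambda>\<phi>. gen \<phi>) \<in> polyfun"
    unfolding gen_def gen_poly_def pencil_def
    by (intro pf_mult polyfun_det2 polyfun_Vmat, unfold fun_diff_def)
      (intro polyfun_diff polyfun_mmul_2 polyfun_adj2 polyfun_Vmat)
  then show ?thesis by simp
qed

text \<open>The triple is the identity and the matrix units at (0, 1) and (1, 0). Its pencil is
  diag(1, -1), whose determinant -1 is nonzero in every characteristic.\<close>

definition gen_point :: "'k::field hm" where
  "gen_point = (\<lambda>s r. if s < 2 \<and> r < 2 then mk 0 0 0 (\<lambda>i.
     if i = 0 then (if s = r then 1 else 0) else if i = 1 then (if s = 0 \<and> r = 1 then 1 else 0)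
     else (if s = 1 \<and> r = 0 then 1 else 0)) 0 0 else 0)"

text \<open>The free tail \<open>M\<close> lets the same point witness genericity for
  \<open>kron\<close> and for the doubled class.\<close>

lemma gen_point_homs: "gen_point \<in> homs 7 alg7 reps [0, 0] (Suc 0 # Suc 0 # M)"
proof (rule homsI)
  show "gen_point s r \<in> alg7" for s r
    by (simp add: gen_point_def mk_alg7 A7.zero_A)
  show "mmul 7 (mmul 7 (reps ! ([0, 0] ! s)) (gen_point s r)) (reps ! ((Suc 0 # Suc 0 # M) ! r)) = gen_point s r"
    if "s < length [0, 0 :: nat]" for s r
  proof -
    have "s = 0 \<or> s = Suc 0" using that by auto
    then have z: "[0, 0] ! s = (0 :: nat)" by auto
    show ?thesis
    proof (cases "r < 2")
      case True
      then have "(Suc 0 # Suc 0 # M) ! r = Suc 0" by (auto simp: less_2_cases_iff)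
      then show ?thesis
        using True unfolding z
        by (simp add: gen_point_def reps_nth mk_mult mk_eq_iff cross_def)
    qed (simp add: gen_point_def)
  qed
qed (auto simp: gen_point_def)

lemma gen_gen_point: "gen gen_point \<noteq> (0 :: 'k::field)"
proof -
  have V: "Vmat gen_point 0 0 0 = (1::'k)" "Vmat gen_point 0 0 (Suc 0) = (0::'k)"
    "Vmat gen_point 0 (Suc 0) 0 = (0::'k)" "Vmat gen_point 0 (Suc 0) (Suc 0) = (1::'k)"
    "Vmat gen_point (Suc 0) 0 0 = (0::'k)" "Vmat gen_point (Suc 0) 0 (Suc 0) = (1::'k)"
    "Vmat gen_point (Suc 0) (Suc 0) 0 = (0::'k)" "Vmat gen_point (Suc 0) (Suc 0) (Suc 0) = (0::'k)"
    "Vmat gen_point 2 0 0 = (0::'k)" "Vmat gen_point 2 0 (Suc 0) = (0::'k)"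
    "Vmat gen_point 2 (Suc 0) 0 = (1::'k)" "Vmat gen_point 2 (Suc 0) (Suc 0) = (0::'k)"
    by (simp_all add: Vmat_def gen_point_def vco_mk)
  show ?thesis
    by (simp add: gen_def gen_poly_def pencil_def det2_def adj2_def mmul_2 V)
qed

lemma indec_elt_Theta: "indec_elt 7 alg7 (reps :: 'k::alg_closed_field sq list) Theta"
  unfolding indec_elt_def Hom\<theta>_def Pf_def length_reps class_lists
proof (rule generalI_homs)
  let ?p = "\<lambda>f :: 'k hm. vco (f 0 0) 0 * uco (f 0 1) 0 + vco (f 0 0) 1 * uco (f 0 1) 1 + vco (f 0 0) 2 * uco (f 0 1) 2"
  let ?f = "\<lambda>s r. if s = 0 \<and> r = 0 then mk 0 0 0 (\<lambda>i. if i = 0 then 1 else 0) 0 0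
    else if s = 0 \<and> r = 1 then mk 0 0 0 0 0 (\<lambda>i. if i = 0 then 1 else 0) else (0 :: 'k sq)"
  show "?p \<in> polyfun"
    by (intro pf_add pf_mult polyfun_vco polyfun_uco)
  show "?f \<in> homs 7 alg7 reps [0] [Suc 0, 2]"
    by (rule homsI) (auto simp: less_Suc_eq mk_alg7 A7.zero_A reps_nth mk_mult mk_eq_iff cross_def)
  show "?p ?f \<noteq> 0"
    by (simp add: vco_def uco_def mk_def skew_def)
qed (use indec_mixed in blast)

lemma indec_elt_kron: "indec_elt 7 alg7 (reps :: 'k::alg_closed_field sq list) kron"
  unfolding indec_elt_def Hom\<theta>_def Pf_def length_reps class_lists
  using polyfun_gen gen_point_homs gen_gen_point indec_kronecker by (rule generalI_homs)

lemma indec_elt_stalk: "indec_elt 7 alg7 (reps :: 'k::alg_closed_field sq list) stalk"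
  unfolding indec_elt_def Hom\<theta>_def Pf_def length_reps class_lists
proof (rule generalI_homs)
  show "(\<lambda>_. 1) \<in> polyfun" by (rule pf_const)
  fix f :: "'k hm" assume f: "f \<in> homs 7 alg7 reps [] [2]"
  have "f = 0" by (rule homs_eqI[OF f A7.homs_zero]) simp
  then show "indec_cplx 7 alg7 reps ([], [2], f)"
    using indec_stalk by simp
qed (rule A7.homs_zero, simp)

text \<open>Modulo null homotopic maps the component in \<open>V\<close> only matters up to the span of two vectors,
which is not all of \<open>V\<close>.\<close>

lemma wild_Theta: "wild 7 alg7 (reps :: 'k::field sq list) Theta"
  unfolding wild_def hom_shift_nonzero_def Hom\<theta>_def length_reps class_lists Let_def
proof (intro ballI, rule ccontr)
  fix f g :: "'k hm"
  assume f: "f \<in> homs 7 alg7 reps [0] [Suc 0, 2]" and g: "g \<in> homs 7 alg7 reps [0] [Suc 0, 2]"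
    and n: "\<not> (\<exists>h\<in>homs 7 alg7 reps [0] [Suc 0, 2].
             \<not> (\<exists>s0\<in>homs 7 alg7 reps [Suc 0, 2] [Suc 0, 2]. \<exists>s1\<in>homs 7 alg7 reps [0] [0].
                    h = hcomp 7 [Suc 0, 2] f s0 + hcomp 7 [0] s1 g))"
  define v where "v = vco (f 0 0)"
  define w where "w = vco (g 0 0)"
  have f00: "f 0 0 = mk 0 0 0 v 0 0" unfolding v_def by (rule homs_entry(2)[OF f]) simp_all
  have g00: "g 0 0 = mk 0 0 0 w 0 0" unfolding w_def by (rule homs_entry(2)[OF g]) simp_all
  have span: "\<exists>a b. \<forall>j<3. e j = a * v j + b * w j" for e :: "nat \<Rightarrow> 'k"
  proof -
    define h :: "'k hm" where "h = (\<lambda>s r. if s = 0 \<and> r = 0 then mk 0 0 0 e 0 0 else 0)"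
    have "h \<in> homs 7 alg7 reps [0] [Suc 0, 2]"
      unfolding h_def
      by (rule homsI) (auto simp: less_Suc_eq mk_alg7 A7.zero_A reps_nth mk_mult mk_eq_iff cross_def)
    then obtain s0 s1 where s0: "s0 \<in> homs 7 alg7 reps [Suc 0, 2] [Suc 0, 2]" and s1: "s1 \<in> homs 7 alg7 reps [0] [0]"
      and h: "h = hcomp 7 [Suc 0, 2] f s0 + hcomp 7 [0] s1 g"
      using n by blast
    obtain p where a: "s0 0 0 = mk 0 p 0 0 0 0" using homs_entry(5)[OF s0, of 0 0] by auto
    obtain q where b: "s1 0 0 = mk q 0 0 0 0 0" using homs_entry(1)[OF s1, of 0 0] by auto
    \<comment> \<open>There is no nonzero map from vertex 2 to vertex 1, so the component of
      \<open>f\<close> in U cannot contribute to the component of \<open>h\<close> in V.\<close>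
    have c: "s0 (Suc 0) 0 = 0" by (rule homs_entry(8)[OF s0]) simp_all
    have "h 0 0 = mmul 7 (f 0 0) (s0 0 0) + mmul 7 (s1 0 0) (g 0 0)"
      by (simp add: h hcomp_singleton hcomp_pair c)
    then have "mk 0 0 0 e 0 0 = mk 0 0 0 (\<lambda>i. v i * p + q * w i) 0 0"
      by (simp add: h_def f00 g00 a b mk_V_mult mk_add mk_eq_iff)
    then have "\<forall>j<3. e j = p * v j + q * w j"
      by (auto simp: mk_eq_iff mult.commute dest!: less_3_cases)
    then show ?thesis by blast
  qed
  have "\<forall>i. \<exists>a b. \<forall>j<3. (if i = j then 1 else 0) = a * v j + b * w j"
    by (rule allI, rule span)
  then obtain a b where ab: "\<And>i j. j < 3 \<Longrightarrow> (if i = j then 1 else 0) = a i * v j + b i * w j"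
    by metis
  have i: "a i * v i + b i * w i = 1" if "i < 3" for i
    using ab[of i i] that by simp
  have o: "a i * v j + b i * w j = 0" if "j < 3" "i \<noteq> j" for i j
    using ab[of j i] that by simp
  \<comment> \<open>A sum of two matrices of rank at most one has vanishing 3x3 determinant, but
    \<open>M\<close> is the identity there.\<close>
  define M where "M = (\<lambda>i j. a i * v j + b i * w j)"
  have "M 0 0 * (M 1 1 * M 2 2 - M 1 2 * M 2 1) - M 0 1 * (M 1 0 * M 2 2 - M 1 2 * M 2 0)
      + M 0 2 * (M 1 0 * M 2 1 - M 1 1 * M 2 0) = 0"
    unfolding M_def by algebra
  then show False
    by (simp add: M_def i o)
qed

section \<open>The decomposition of the doubled class\<close>

lemma kiso_of_automorphism:
  fixes f g :: "'k::field hm"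
  assumes f: "f \<in> homs 7 alg7 reps L M" and g: "g \<in> homs 7 alg7 reps L M"
    and v: "A7.valid TYPE('k) L" "A7.valid TYPE('k) M"
    and d: "d \<in> homs 7 alg7 reps M M" and e: "e \<in> homs 7 alg7 reps M M"
    and de: "hcomp 7 M d e = hid reps M" "hcomp 7 M e d = hid reps M"
    and fd: "hcomp 7 M f d = g"
  shows "kiso 7 alg7 reps (L, M, f) (L, M, g)"
proof -
  have ge: "hcomp 7 M g e = f"
    using A7.hcomp_hid_right[OF f v(2)] by (simp add: hcomp_assoc de flip: fd)
  have "chain_map 7 alg7 reps (L, M, f) (L, M, g) (hid reps L, d)"
    by (simp add: chain_map_def A7.hid_homs v d fd A7.hcomp_hid_left[OF g v(1)])
  moreover have "chain_map 7 alg7 reps (L, M, g) (L, M, f) (hid reps L, e)"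
    by (simp add: chain_map_def A7.hid_homs v e ge A7.hcomp_hid_left[OF f v(1)])
  moreover have "ccomp 7 (L, M, g) (hid reps L, d) (hid reps L, e) = cid reps (L, M, f)"
    "ccomp 7 (L, M, f) (hid reps L, e) (hid reps L, d) = cid reps (L, M, g)"
    by (simp_all add: ccomp_def cid_def de A7.hcomp_hid_hid v)
  ultimately show ?thesis
    unfolding kiso_def homotopic_iff_null
    by (intro exI conjI) (assumption | simp add: A7.null_zero)+
qed

text \<open>The base change \<open>1 + \<omega>\<close> of the target, with \<omega> leading from
  the copies of vertex 1 to those of vertex 2, has inverse \<open>1 - \<omega>\<close> because
  \<omega> squares to 0. It adds a cross product to the component in U, and
  \<open>triple_solve\<close> chooses \<omega> so that this cancels \<open>Umat\<close>.\<close>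

lemma split_stalks:
  fixes f :: "'k::field hm"
  assumes f: "f \<in> homs 7 alg7 reps [0, 0] [Suc 0, Suc 0, 2, 2]" and g: "gen f \<noteq> 0"
  defines "f1 \<equiv> (\<lambda>s r. if s < 2 \<and> r < 2 then f s r else 0)"
  shows "kiso 7 alg7 reps ([0, 0], [Suc 0, Suc 0, 2, 2], f) ([0, 0], [Suc 0, Suc 0, 2, 2], f1)"
proof -
  let ?L = "[0, 0] :: nat list" and ?M = "[Suc 0, Suc 0, 2, 2] :: nat list"
  have v: "A7.valid TYPE('k) ?L" "A7.valid TYPE('k) ?M"
    by (auto simp: A7.valid_def length_reps)
  have M_nth: "r < 4 \<Longrightarrow> r < 2 \<and> ?M ! r = Suc 0 \<or> 2 \<le> r \<and> ?M ! r = 2" for r :: nat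
    by (auto simp: eval_nat_numeral less_Suc_eq)
  have L_nth: "s < 2 \<Longrightarrow> ?L ! s = 0" for s :: nat
    by (auto simp: less_2_cases_iff)
  obtain I J where IJ: "I \<in> supp_sq 2" "J \<in> supp_sq 2"
    "mmul 2 (Vmat f 0) I = munit 2" "mmul 2 I (Vmat f 0) = munit 2"
    "mmul 2 (pencil I (Vmat f 0) (Vmat f 1) (Vmat f 2)) J = munit 2"
    using gen_poly_inverses[OF Vmat_supp Vmat_supp Vmat_supp g[unfolded gen_def]] by blast
  have neg: "- Umat f i \<in> supp_sq 2" for i
    by (simp add: Umat_def supp_sq_def)
  obtain X0 X1 X2 where X:
    "mmul 2 (Vmat f 1) X2 - mmul 2 (Vmat f 2) X1 = - Umat f 0"
    "mmul 2 (Vmat f 2) X0 - mmul 2 (Vmat f 0) X2 = - Umat f 1"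
    "mmul 2 (Vmat f 0) X1 - mmul 2 (Vmat f 1) X0 = - Umat f 2"
    using triple_solve[OF Vmat_supp Vmat_supp Vmat_supp IJ neg neg neg] by blast
  define w where "w = (\<lambda>t r i. if i = 0 then X0 t r else if i = (1::nat) then X1 t r else X2 t r)"
  define \<omega> :: "'k hm" where
    "\<omega> = (\<lambda>t r. if t < 2 \<and> 2 \<le> r \<and> r < 4 then mk 0 0 0 0 (w t (r - 2)) 0 else 0)"
  have \<omega>: "\<omega> \<in> homs 7 alg7 reps ?M ?M"
  proof (rule homsI)
    fix s r assume "s < length ?M" "r < length ?M"
    then show "\<omega> s r \<in> alg7" "mmul 7 (mmul 7 (reps ! (?M ! s)) (\<omega> s r)) (reps ! (?M ! r)) = \<omega> s r"
      using M_nth[of s] M_nth[of r]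
      by (auto simp: \<omega>_def mk_alg7 A7.zero_A reps_nth mk_mult mk_eq_iff cross_def)
  qed (auto simp: \<omega>_def)
  have hc: "hcomp 7 ?M \<phi> \<psi> s r = mmul 7 (\<phi> s 0) (\<psi> 0 r) + mmul 7 (\<phi> s 1) (\<psi> 1 r)
      + mmul 7 (\<phi> s 2) (\<psi> 2 r) + mmul 7 (\<phi> s 3) (\<psi> 3 r)" for \<phi> \<psi> :: "'k hm" and s r
    by (simp add: hcomp_def eval_nat_numeral)
  have \<omega>\<omega>: "hcomp 7 ?M \<omega> \<omega> = 0"
    by (rule ext, rule ext, unfold hc) (simp add: \<omega>_def)
  have fe: "f s r = mk 0 0 0 (\<lambda>i. Vmat f i s r) 0 0" if "s < 2" "r < 2" for s r
  proof -
    have "f s r = mk 0 0 0 (vco (f s r)) 0 0"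
      using that L_nth[of s] M_nth[of r] by (intro homs_entry(2)[OF f]) auto
    then show ?thesis
      using that by (simp add: Vmat_def mk_eq_iff)
  qed
  have fu: "f s (Suc (Suc r)) = mk 0 0 0 0 0 (\<lambda>i. Umat f i s r)" if "s < 2" "r < 2" for s r
  proof -
    have "f s (Suc (Suc r)) = mk 0 0 0 0 0 (uco (f s (Suc (Suc r))))"
      using that L_nth[of s] M_nth[of "Suc (Suc r)"] by (intro homs_entry(3)[OF f]) auto
    then show ?thesis
      using that by (simp add: Umat_def mk_eq_iff)
  qed
  have f1: "f1 \<in> homs 7 alg7 reps ?L ?M"
    by (rule homsI) (auto simp: f1_def homsD[OF f] A7.zero_A)
  have f\<omega>: "hcomp 7 ?M f \<omega> = f1 - f"
  proof (rule homs_eqI[OF A7.homs_hcomp[OF f \<omega> v] A7.homs_diff[OF f1 f]])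
    fix s r assume "s < length ?L" "r < length ?M"
    then have s: "s < 2" and r: "r < 4" by simp_all
    show "hcomp 7 ?M f \<omega> s r = (f1 - f) s r"
    proof (cases "r < 2")
      case True
      then show ?thesis
        using s unfolding hc by (simp add: \<omega>_def f1_def)
    next
      case False
      define t where "t = r - 2"
      have t: "r = Suc (Suc t)" "t < 2"
        using False r by (simp_all add: t_def)
      have e: "\<omega> 0 r = mk 0 0 0 0 (w 0 t) 0" "\<omega> 1 r = mk 0 0 0 0 (w 1 t) 0" "\<omega> 2 r = 0" "\<omega> 3 r = 0"
        using False r by (simp_all add: \<omega>_def t_def)
      have "(mmul 2 (Vmat f 1) X2 - mmul 2 (Vmat f 2) X1) s t = (- Umat f 0) s t"
        "(mmul 2 (Vmat f 2) X0 - mmul 2 (Vmat f 0) X2) s t = (- Umat f 1) s t"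
        "(mmul 2 (Vmat f 0) X1 - mmul 2 (Vmat f 1) X0) s t = (- Umat f 2) s t"
        using X by simp_all
      then have "hcomp 7 ?M f \<omega> s r = mk 0 0 0 0 0 (\<lambda>i. - Umat f i s t)"
        unfolding hc e using s
        by (simp add: fe mk_V_mult mk_add mk_eq_iff cross_def w_def mmul_2 algebra_simps)
      also have "\<dots> = - f s r"
        unfolding t(1) fu[OF s t(2)] by (auto simp: mk_def skew_def fun_eq_iff)
      finally show ?thesis
        using False by (simp add: f1_def)
    qed
  qed
  have id: "(hid reps ?M :: 'k hm) \<in> homs 7 alg7 reps ?M ?M"
    using v(2) by (rule A7.hid_homs(1))
  show ?thesis
  proof (rule kiso_of_automorphism[OF f f1 v A7.homs_add[OF id \<omega>] A7.homs_diff[OF id \<omega>]])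
    show "hcomp 7 ?M (hid reps ?M + \<omega>) (hid reps ?M - \<omega>) = hid reps ?M"
      "hcomp 7 ?M (hid reps ?M - \<omega>) (hid reps ?M + \<omega>) = hid reps ?M"
      by (simp_all only: hcomp_add_left hcomp_add_right hcomp_diff_left hcomp_diff_right \<omega>\<omega>
          A7.hcomp_hid_left[OF \<omega> v(2)] A7.hcomp_hid_right[OF \<omega> v(2)] A7.hcomp_hid_hid[OF v(2) order_refl]) simp_all
    show "hcomp 7 ?M f (hid reps ?M + \<omega>) = f1"
      by (simp add: hcomp_add_right A7.hcomp_hid_right[OF f v(2)] f\<omega>)
  qed
qed

text \<open>The genericity condition is again \<open>gen\<close>, which sees only the components in
  V.\<close>

lemma canon_decomp_double:
  "canon_decomp 7 alg7 (reps :: 'k::alg_closed_field sq list) (\<lambda>i. 2 * Theta i) [kron, stalk, stalk]"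
  unfolding canon_decomp_def
proof (intro conjI ballI)
  show "(\<lambda>i. 2 * Theta i) = sum_list [kron, stalk, stalk]"
    by (auto simp: fun_eq_iff Theta_def kron_def stalk_def)
  show "t \<in> K0 (length (reps :: 'k sq list))" "indec_elt 7 alg7 (reps :: 'k sq list) t"
    if "t \<in> set [kron, stalk, stalk]" for t
    using that indec_elt_kron indec_elt_stalk by (auto simp: K0_def length_reps kron_def stalk_def)
  show "general (Hom\<theta> 7 alg7 (reps :: 'k sq list) (\<lambda>i. 2 * Theta i)) (\<lambda>f. \<exists>fs. length fs = length [kron, stalk, stalk] \<and>
        (\<forall>i<length [kron, stalk, stalk]. fs!i \<in> Hom\<theta> 7 alg7 reps ([kron, stalk, stalk]!i)) \<and>
        kiso 7 alg7 reps (Pf reps (\<lambda>i. 2 * Theta i) f)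
          (dsums (map (\<lambda>i. Pf reps ([kron, stalk, stalk]!i) (fs!i)) [0..<length [kron, stalk, stalk]])))"
    unfolding Hom\<theta>_def length_reps class_lists
  proof (rule generalI_homs[OF polyfun_gen gen_point_homs gen_gen_point])
    fix f :: "'k hm"
    assume f: "f \<in> homs 7 alg7 reps [0, 0] [Suc 0, Suc 0, 2, 2]" and g: "gen f \<noteq> 0"
    define f1 where "f1 = (\<lambda>s r. if s < 2 \<and> r < 2 then f s r else 0)"
    have f1: "f1 \<in> homs 7 alg7 reps [0, 0] [Suc 0, Suc 0]"
    proof (rule homsI)
      fix s r assume "s < length [0, 0 :: nat]" "r < length [Suc 0, Suc 0]"
      then have "s < 2" "r < 2" "[Suc 0, Suc 0] ! r = [Suc 0, Suc 0, 2, 2] ! r"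
        by (auto simp: less_Suc_eq)
      then show "f1 s r \<in> alg7"
        "mmul 7 (mmul 7 (reps ! ([0, 0] ! s)) (f1 s r)) (reps ! ([Suc 0, Suc 0] ! r)) = f1 s r"
        using homsD(1,2)[OF f, of s r] by (simp_all add: f1_def)
    qed (auto simp: f1_def)
    \<comment> \<open>The stalks have empty source, so they only append two zero columns to
      \<open>f1\<close>, which vanishes there already.\<close>
    have "dsums (map (\<lambda>i. Pf reps ([kron, stalk, stalk]!i) ([f1, 0, 0]!i)) [0..<length [kron, stalk, stalk]]) =
        ([0, 0], [Suc 0, Suc 0, 2, 2], f1)"
      by (simp add: upt_3 Pf_def length_reps class_lists dsums_def dsum_def zero_cplx_def)
        (auto simp: fun_eq_iff f1_def)
    moreover have "kiso 7 alg7 reps (Pf reps (\<lambda>i. 2 * Theta i) f) ([0, 0], [Suc 0, Suc 0, 2, 2], f1)"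
      using split_stalks[OF f g] by (simp add: Pf_def length_reps class_lists f1_def)
    moreover have "\<forall>i<length [kron, stalk, stalk]. [f1, 0, 0]!i \<in>
        homs 7 alg7 reps (neg_list 3 ([kron, stalk, stalk] ! i)) (pos_list 3 ([kron, stalk, stalk] ! i))"
      by (auto simp: less_Suc_eq class_lists f1 A7.homs_zero)
    ultimately show "\<exists>fs. length fs = length [kron, stalk, stalk] \<and>
        (\<forall>i<length [kron, stalk, stalk]. fs!i \<in> homs 7 alg7 reps (neg_list 3 ([kron, stalk, stalk] ! i)) (pos_list 3 ([kron, stalk, stalk] ! i))) \<and>
        kiso 7 alg7 reps (Pf reps (\<lambda>i. 2 * Theta i) f)
          (dsums (map (\<lambda>i. Pf reps ([kron, stalk, stalk]!i) (fs!i)) [0..<length [kron, stalk, stalk]]))"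
      by (intro exI[of _ "[f1, 0, 0]"]) simp
  qed
qed

lemma cone_mono:
  assumes "X \<subseteq> Y"
  shows "cone X \<subseteq> cone Y"
proof
  fix v assume "v \<in> cone X"
  then obtain S c where "finite S" "S \<subseteq> X" "\<forall>x\<in>S. c x \<ge> (0::real)"
    "v = (\<lambda>i. \<Sum>x\<in>S. c x * real_of_int (x i))"
    unfolding cone_def mem_Collect_eq by (elim exE conjE) (rule that)
  then show "v \<in> cone Y"
    unfolding cone_def mem_Collect_eq using assms by (intro exI[of _ S] exI[of _ c]) simp
qed

theorem theorem1p6:
  fixes k_type :: "'k::alg_closed_field itself"
  shows "\<exists>(N::nat) (A::'k sq set) (E::'k sq list) (\<theta>::nat \<Rightarrow> int).
     fd_alg N A \<and> complete_reps N A E \<and> \<theta> \<in> K0 (length E) \<and>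
     indec_elt N A E \<theta> \<and> wild N A E \<theta> \<and>
     cone (ind N A E \<theta>) \<subset> cone (indN N A E \<theta>) \<and>
     (\<exists>l::nat. l \<ge> 1 \<and> \<not> indec_elt N A E (\<lambda>i. int l * \<theta> i))"
proof (intro exI conjI)
  let ?E = "reps :: 'k sq list"
  let ?ind = "ind 7 alg7 ?E Theta" and ?indN = "indN 7 alg7 ?E Theta"
  show "fd_alg 7 (alg7 :: 'k sq set)" by (rule fd_alg7)
  show "complete_reps 7 alg7 ?E" by (rule complete_reps_reps)
  show "Theta \<in> K0 (length ?E)" by (simp add: K0_def length_reps Theta_def)
  show "indec_elt 7 alg7 ?E Theta" by (rule indec_elt_Theta)
  show "wild 7 alg7 ?E Theta" by (rule wild_Theta)
  show "(1::nat) \<le> 2" by simp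
  \<comment> \<open>Otherwise the decomposition with three members would have to be a
    singleton.\<close>
  show "\<not> indec_elt 7 alg7 ?E (\<lambda>i. int 2 * Theta i)"
    using A7.canon_decomp_indec_elt[OF _ canon_decomp_double] by auto
  have "ind 7 alg7 ?E (\<lambda>i. int 1 * Theta i) \<subseteq> ?indN" "ind 7 alg7 ?E (\<lambda>i. int 2 * Theta i) \<subseteq> ?indN"
    unfolding indN_def by (intro UN_upper; simp)+
  moreover have "stalk \<in> ind 7 alg7 ?E (\<lambda>i. int 2 * Theta i)"
    unfolding ind_def using canon_decomp_double[where 'k = 'k] by force
  ultimately have sub: "?ind \<subseteq> ?indN" and "stalk \<in> ?indN"
    by auto
  define x where "x = (\<lambda>i. real_of_int (stalk i))"
  have "x \<in> cone ?indN"
    unfolding cone_def using \<open>stalk \<in> ?indN\<close>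
    by (auto simp: x_def intro!: exI[of _ "{stalk}"] exI[of _ "\<lambda>_. 1"])
  moreover have "x \<notin> cone ?ind"
  proof
    assume "x \<in> cone ?ind"
    then obtain S c where S: "S \<subseteq> ?ind" and x: "x = (\<lambda>i. \<Sum>t\<in>S. c t * real_of_int (t i))"
      unfolding cone_def mem_Collect_eq by (elim exE conjE) (rule that)
    have "t = Theta" if "t \<in> S" for t
      using that S A7.canon_decomp_indec_elt[OF indec_elt_Theta] by (fastforce simp: ind_def)
    then have "x i = (\<Sum>t\<in>S. c t * real_of_int (Theta i))" for i
      unfolding x by (intro sum.cong) auto
    \<comment> \<open>On the line through \<open>Theta\<close> the coordinates 0 and 2 are opposite,
      whereas those of \<open>stalk\<close> are 0 and 1.\<close>
    then have "x 0 = - x 2"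
      by (simp add: Theta_def sum_negf)
    then show False
      by (simp add: x_def stalk_def)
  qed
  ultimately show "cone ?ind \<subset> cone ?indN"
    using cone_mono[OF sub] by blast
qed

end
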